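(* Let $N \ge 1$ be an integer, let $\ell \ge 1$ be an integer, let $s > \ell$ be a real number with $s \notin \mathbb{N}$, and let $1 \le p < \infty$. Then there exists a constant $C$ (depending only on $N,\ell,s,p$) such that for every $u \in W^{s, p} (\mathbb{R}^N) \cap \mathrm{BMO} (\mathbb{R}^N)$, one has $u \in W^{\ell, \frac{sp}{\ell}} (\mathbb{R}^N)$ and \[ \|D^\ell u\|_{L^{s p/\ell} (\mathbb{R}^N)} \le C\, |u|_{\mathrm{BMO} (\mathbb{R}^N)}^{1 - \frac{\ell}{s}} \, |u|_{W^{s, p}(\mathbb{R}^N)}^{\frac{\ell}{s}}. \]
   Context: For non-integer $s>0$ write $s=k+\sigma$ with $k\in\mathbb{N}$ and $0<\sigma<1$. $W^{s,p}(\mathbb{R}^N)$ is the fractional Sobolev space of functions $u\in W^{k,p}(\mathbb{R}^N)$ with finite semi-norm \[ |u|_{W^{s,p}(\mathbb{R}^N)} = \Bigl(\int_{\mathbb{R}^N} \int_{\mathbb{R}^N} \frac{|D^k u (x) - D^k u (y)|^p}{|x - y|^{N + \sigma p}} \,\mathrm{d} x \,\mathrm{d} y\Bigr)^{1/p}, \] where $D^j u$ denotes the (tensor-valued) weak derivative of order $j$. The space $\mathrm{BMO}(\mathbb{R}^N)$ consists of locally integrable functions with finite semi-norm \[ |u|_{\mathrm{BMO} (\mathbb{R}^N)} = \sup_{x \in \mathbb{R}^N,\; r > 0} \frac{1}{|B_r(x)|^2}\int_{B_r (x)}\int_{B_r (x)} |u (y) - u (z)|\,\mathrm{d} z \,\mathrm{d}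 y, \] where $B_r(x)$ is the ball of radius $r$ centred at $x$. *)

theory Defs
  imports "HOL-Analysis.Analysis"
begin

section \<open>Lebesgue spaces on \<open>\<real>\<^sup>N\<close>\<close>

text \<open>Functions are not identified when they agree almost everywhere; membership in
  the spaces below and the (semi-)norms are invariant under modification on a null set.\<close>

definition locally_integrable :: "(real ^ 'n \<Rightarrow> real) \<Rightarrow> bool" where
  "locally_integrable u \<longleftrightarrow> (\<forall>K. compact K \<longrightarrow> set_integrable lebesgue K u)"

definition Lp_space :: "real \<Rightarrow> (real ^ 'n \<Rightarrow> real) set" where
  "Lp_space p = {u \<in> borel_measurable lebesgue. integrable lebesgue (\<lambda>x. \<bar>u x\<bar> powr p)}"

definition Lp_norm :: "real \<Rightarrow> (real ^ 'n \<Rightarrow> real) \<Rightarrow> real" where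
  "Lp_norm p u = (LINT x|lebesgue. \<bar>u x\<bar> powr p) powr (1 / p)"


section \<open>Weak derivatives\<close>

text \<open>The components of a tensor of order \<open>j\<close> are indexed by the lists of length \<open>j\<close> over the
  coordinate type \<open>'n\<close>.\<close>

definition partial_deriv :: "'n \<Rightarrow> (real ^ 'n \<Rightarrow> real) \<Rightarrow> real ^ 'n \<Rightarrow> real" where
  "partial_deriv i f x = frechet_derivative f (at x) (axis i 1)"

fun iter_partial :: "'n list \<Rightarrow> (real ^ 'n \<Rightarrow> real) \<Rightarrow> real ^ 'n \<Rightarrow> real" where
  "iter_partial [] f = f"
| "iter_partial (i # is) f = partial_deriv i (iter_partial is f)"

definition smooth :: "(real ^ 'n \<Rightarrow> real) \<Rightarrow> bool" where
  "smooth f \<longleftrightarrow> (\<forall>is x. iter_partial is f differentiable (at x))"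

definition test_function :: "(real ^ 'n \<Rightarrow> real) \<Rightarrow> bool" where
  "test_function \<phi> \<longleftrightarrow> smooth \<phi> \<and> compact (closure {x. \<phi> x \<noteq> 0})"

definition has_weak_deriv ::
    "(real ^ 'n \<Rightarrow> real) \<Rightarrow> 'n list \<Rightarrow> (real ^ 'n \<Rightarrow> real) \<Rightarrow> bool" where
  "has_weak_deriv u is g \<longleftrightarrow>
     locally_integrable u \<and> locally_integrable g \<and>
     (\<forall>\<phi>. test_function \<phi> \<longrightarrow>
        (LINT x|lebesgue. u x * iter_partial is \<phi> x) =
        (- 1) ^ length is * (LINT x|lebesgue. g x * \<phi> x))"

text \<open>A representative of the weak derivative, which is unique up to null sets when it exists.\<close>

definition weak_deriv :: "(real ^ 'n \<Rightarrow> real) \<Rightarrow> 'n list \<Rightarrow> real ^ 'n \<Rightarrow> real" where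
  "weak_deriv u is = (SOME g. has_weak_deriv u is g)"

definition tensor_norm :: "nat \<Rightarrow> ('n list \<Rightarrow> real) \<Rightarrow> real" where
  "tensor_norm j T = L2_set T {is. length is = j}"


section \<open>Sobolev spaces\<close>

definition sobolev :: "nat \<Rightarrow> real \<Rightarrow> (real ^ 'n \<Rightarrow> real) set" where
  "sobolev k p = {u \<in> Lp_space p.
     \<forall>is. length is \<le> k \<longrightarrow> (\<exists>g \<in> Lp_space p. has_weak_deriv u is g)}"

text \<open>For non-integer \<open>s > 0\<close> the decomposition \<open>s = k + \<sigma>\<close> is \<open>k = nat \<lfloor>s\<rfloor>\<close> and \<open>\<sigma> = frac s\<close>.
  The integrand takes the value \<open>0\<close> on the diagonal, by the convention \<open>x / 0 = 0\<close>.\<close>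

definition gagliardo_energy :: "real \<Rightarrow> real \<Rightarrow> (real ^ 'n \<Rightarrow> real) \<Rightarrow> ennreal" where
  "gagliardo_energy s p u =
     (\<integral>\<^sup>+ y. \<integral>\<^sup>+ x.
        ennreal (tensor_norm (nat \<lfloor>s\<rfloor>) (\<lambda>is. weak_deriv u is x - weak_deriv u is y) powr p /
                 norm (x - y) powr (real CARD('n) + frac s * p)) \<partial>lebesgue \<partial>lebesgue)"

definition frac_sobolev :: "real \<Rightarrow> real \<Rightarrow> (real ^ 'n \<Rightarrow> real) set" where
  "frac_sobolev s p = {u \<in> sobolev (nat \<lfloor>s\<rfloor>) p. gagliardo_energy s p u < \<infinity>}"

definition frac_sobolev_seminorm :: "real \<Rightarrow> real \<Rightarrow> (real ^ 'n \<Rightarrow> real) \<Rightarrow> real" where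
  "frac_sobolev_seminorm s p u = enn2real (gagliardo_energy s p u) powr (1 / p)"


section \<open>Bounded mean oscillation\<close>

definition mean_oscillation :: "(real ^ 'n \<Rightarrow> real) \<Rightarrow> (real ^ 'n) set \<Rightarrow> ennreal" where
  "mean_oscillation u B =
     (\<integral>\<^sup>+ y \<in> B. (\<integral>\<^sup>+ z \<in> B. ennreal \<bar>u y - u z\<bar> \<partial>lebesgue) \<partial>lebesgue) /
     (emeasure lebesgue B)\<^sup>2"

definition bmo_oscillation :: "(real ^ 'n \<Rightarrow> real) \<Rightarrow> ennreal" where
  "bmo_oscillation u = (SUP x. SUP r\<in>{0<..}. mean_oscillation u (ball x r))"

definition BMO :: "(real ^ 'n \<Rightarrow> real) set" where
  "BMO = {u. locally_integrable u \<and> bmo_oscillation u < \<infinity>}"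

definition bmo_seminorm :: "(real ^ 'n \<Rightarrow> real) \<Rightarrow> real" where
  "bmo_seminorm u = enn2real (bmo_oscillation u)"

end

(* Average the weak derivative D^j u against dilates of a fixed smooth bump at scale r.
   Integrating by parts and subtracting a mean of u, the average at scale r is at most
   C |u|_BMO / r^j for j >= 1.  For j = k = floor s, averages at x at scales at most r differ by
   at most C r^\<sigma> g(x), where g(x)^p is the inner integral of the Gagliardo energy at x.  The
   r-derivative of the bump is a divergence, so the r-derivative of an average of D^j u is a
   sum of averages of D^(j+1) u, and downward induction on j gives the bound
   C (|u|_BMO / r^j + r^(s-j) g(x)) at all scales at most r.  Choosing r^s = |u|_BMO / g(x) yields
   the pointwise inequality |D^l u| <= C |u|_BMO^(1-l/s) g^(l/s), which is raised to the power
   s p / l and integrated.  No maximal function and no Lebesgue differentiation theorem is needed: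
   the bound on averages passes to the function itself by testing against nonnegative test
   functions.  The lower-order derivatives (and u itself) lie in L^(s p / l) because they are in
   L^p and are bounded by a constant plus a multiple of g^(l/s). *)

theory Submission
  imports Defs
begin

subsection \<open>Elementary smooth functions\<close>

text \<open>The induction over the order cannot be run with one fixed bump. Differentiating an
  average in its scale replaces the kernel \<open>L\<close> by \<open>z $ i * L z\<close>, and
  moving weak derivatives onto the kernel replaces it by iterated partial derivatives. The estimates
  are therefore stated for every kernel of a class closed under both operations. Since
  \<open>smooth\<close> asks for differentiability of every iterated partial derivative, that class
  is generated syntactically. Order zero is the exception: BMO is blind to constants, so oscillation
  does not bound the averages of \<open>u\<close> itself at any scale. They are anchored at scale 1
  by membership in L^p. This suffices because at orders below l only membership in L^(s p / l) is
  claimed, so constants may depend on \<open>u\<close> there. At order k the value of D^k u at x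
  enters only as a common reference for two scales, and it cancels.\<close>

definition flat :: "nat \<Rightarrow> real \<Rightarrow> real" where
  "flat m t = (if t > 0 then exp (- 1 / t) / t ^ m else 0)"

text \<open>With x = 1/t the quotient is x^(m+1) / exp x to the right of 0, and it vanishes to the
  left. It is the difference quotient of \<open>flat m\<close> at 0.\<close>

lemma flat_quotient_tendsto_0: "((\<lambda>t. flat m t / t) \<longlongrightarrow> 0) (at 0)"
proof -
  have "((\<lambda>t::real. inverse t ^ Suc m / exp (inverse t)) \<longlongrightarrow> 0) (at_right 0)"
    by (rule filterlim_compose[OF tendsto_power_div_exp_0 filterlim_inverse_at_top_right])
  moreover have "inverse t ^ Suc m / exp (inverse t) = flat m t / t" if "t > 0" for t :: real
    using that by (simp add: flat_def exp_minus field_simps)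
  ultimately have "((\<lambda>t. flat m t / t) \<longlongrightarrow> 0) (at_right 0)"
    by (auto intro: Lim_transform_eventually simp: eventually_at_right_less eventually_at_filter)
  moreover have "((\<lambda>t. flat m t / t) \<longlongrightarrow> 0) (at_left 0)"
    by (rule tendsto_eventually) (auto simp: flat_def eventually_at_filter)
  ultimately show ?thesis
    by (simp add: filterlim_at_split)
qed

text \<open>The powers of 1/t belong to the family because differentiating exp(-1/t) creates them;
  its linear span is closed under derivatives. At 0 the derivative is the limit just
  computed.\<close>

lemma flat_deriv: "(flat m has_real_derivative flat (m + 2) t - real m * flat (m + 1) t) (at t)"
proof -
  consider "t > 0" | "t < 0" | "t = 0" by linarith
  then show ?thesis
  proof cases
    case 1
    have "((\<lambda>t. exp (- 1 / t) / t ^ m) has_real_derivative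
        flat (m + 2) t - real m * flat (m + 1) t) (at t)"
      using 1 by (auto intro!: derivative_eq_intros simp: flat_def)
         (cases m; simp add: field_simps power2_eq_square)
    then show ?thesis
      by (rule has_field_derivative_transform_within_open[where S="{0<..}"])
         (use 1 in \<open>auto simp: flat_def\<close>)
  next
    case 2
    have "((\<lambda>t. 0) has_real_derivative flat (m + 2) t - real m * flat (m + 1) t) (at t)"
      using 2 by (simp add: flat_def)
    then show ?thesis
      by (rule has_field_derivative_transform_within_open[where S="{..<0}"])
         (use 2 in \<open>auto simp: flat_def\<close>)
  next
    case 3
    then show ?thesis
      using flat_quotient_tendsto_0[of m]
      by (simp add: has_field_derivative_iff) (simp add: flat_def)
  qed
qed

text \<open>A class of smooth functions closed under the partial derivatives, rich enough to contain
  bump functions.\<close>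

inductive_set elementary :: "(real ^ 'n \<Rightarrow> real) set" where
  const: "(\<lambda>_. c) \<in> elementary"
| coord: "(\<lambda>x. x $ i) \<in> elementary"
| add: "f \<in> elementary \<Longrightarrow> g \<in> elementary \<Longrightarrow> (\<lambda>x. f x + g x) \<in> elementary"
| mult: "f \<in> elementary \<Longrightarrow> g \<in> elementary \<Longrightarrow> (\<lambda>x. f x * g x) \<in> elementary"
| flat: "f \<in> elementary \<Longrightarrow> (\<lambda>x. flat m (f x)) \<in> elementary"
| exp: "f \<in> elementary \<Longrightarrow> (\<lambda>x. exp (f x)) \<in> elementary"

lemma elementary_diff:
  "f \<in> elementary \<Longrightarrow> g \<in> elementary \<Longrightarrow> (\<lambda>x. f x - g x) \<in> elementary"
  using elementary.add[OF _ elementary.mult[OF elementary.const[of "-1"]], of f g] by simp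

lemma elementary_sum:
  "(\<And>i. i \<in> I \<Longrightarrow> f i \<in> elementary) \<Longrightarrow> (\<lambda>x. \<Sum>i\<in>I. f i x) \<in> elementary"
  by (induction I rule: infinite_finite_induct) (auto intro: elementary.intros)

lemma elementary_prod:
  "(\<And>i. i \<in> I \<Longrightarrow> f i \<in> elementary) \<Longrightarrow> (\<lambda>x. \<Prod>i\<in>I. f i x) \<in> elementary"
  by (induction I rule: infinite_finite_induct) (auto intro: elementary.intros)

text \<open>The induction carries a whole gradient with elementary components, so differentiability
  and closure under partial derivatives come out together. Iterating it yields
  \<open>smooth\<close>.\<close>

lemma elementary_gradient:
  fixes f :: "real ^ 'n \<Rightarrow> real"
  assumes "f \<in> elementary"
  shows "\<exists>g. (\<forall>i. g i \<in> elementary) \<and>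
    (\<forall>x. (f has_derivative (\<lambda>h. \<Sum>i\<in>UNIV. g i x * h $ i)) (at x))"
  using assms
proof induction
  case (const c)
  show ?case
    by (rule exI[of _ "\<lambda>_ _. 0"]) (auto intro: elementary.intros)
next
  case (coord i)
  have "(\<lambda>h. \<Sum>j\<in>UNIV. (if j = i then 1 else 0) * h $ j) = (\<lambda>h::real^'n. h $ i)"
    by (simp add: if_distrib[where f="\<lambda>x. x * _"] cong: if_cong)
  moreover have "((\<lambda>x::real^'n. x $ i) has_derivative (\<lambda>h. h $ i)) (at x)" for x
    by (rule bounded_linear_imp_has_derivative[OF bounded_linear_vec_nth])
  ultimately show ?case
    by (intro exI[of _ "\<lambda>j _. if j = i then 1 else 0"]) (auto intro: elementary.intros)
next
  case (add f g)
  then obtain f' g' where f': "\<forall>i. f' i \<in> elementary"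
    "\<And>x. (f has_derivative (\<lambda>h. \<Sum>i\<in>UNIV. f' i x * h $ i)) (at x)"
    and g': "\<forall>i. g' i \<in> elementary"
    "\<And>x. (g has_derivative (\<lambda>h. \<Sum>i\<in>UNIV. g' i x * h $ i)) (at x)" by blast
  have "((\<lambda>x. f x + g x) has_derivative (\<lambda>h. \<Sum>i\<in>UNIV. (f' i x + g' i x) * h $ i)) (at x)" for x
    by (rule has_derivative_eq_rhs[OF has_derivative_add[OF f'(2) g'(2)]])
       (simp add: sum.distrib distrib_right)
  then show ?case
    using f' g' by (intro exI[of _ "\<lambda>i x. f' i x + g' i x"]) (auto intro: elementary.intros)
next
  case (mult f g)
  then obtain f' g' where f': "\<forall>i. f' i \<in> elementary"
    "\<And>x. (f has_derivative (\<lambda>h. \<Sum>i\<in>UNIV. f' i x * h $ i)) (at x)"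
    and g': "\<forall>i. g' i \<in> elementary"
    "\<And>x. (g has_derivative (\<lambda>h. \<Sum>i\<in>UNIV. g' i x * h $ i)) (at x)" by blast
  have "((\<lambda>x. f x * g x) has_derivative
      (\<lambda>h. \<Sum>i\<in>UNIV. (f x * g' i x + f' i x * g x) * h $ i)) (at x)" for x
    by (rule has_derivative_eq_rhs[OF has_derivative_mult[OF f'(2) g'(2)]])
       (simp add: sum.distrib distrib_right sum_distrib_left sum_distrib_right algebra_simps)
  moreover have "(\<lambda>x. f x * g' i x + f' i x * g x) \<in> elementary" for i
    using f' g' mult.hyps by (intro elementary.add elementary.mult) auto
  ultimately show ?case
    by (intro exI[of _ "\<lambda>i x. f x * g' i x + f' i x * g x"]) auto
next
  case (flat f m)
  then obtain f' where f': "\<forall>i. f' i \<in> elementary"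
    "\<And>x. (f has_derivative (\<lambda>h. \<Sum>i\<in>UNIV. f' i x * h $ i)) (at x)" by blast
  have "((\<lambda>x. flat m (f x)) has_derivative
      (\<lambda>h. \<Sum>i\<in>UNIV. (flat (m + 2) (f x) - real m * flat (m + 1) (f x)) * f' i x * h $ i)) (at x)" for x
    by (rule has_derivative_eq_rhs[OF has_derivative_compose[OF f'(2)
          flat_deriv[unfolded has_field_derivative_def]]])
       (simp add: sum_distrib_left mult.assoc)
  then show ?case
    using f' flat.hyps
    by (intro exI[of _ "\<lambda>i x. (flat (m + 2) (f x) - real m * flat (m + 1) (f x)) * f' i x"])
       (auto intro!: elementary.intros elementary_diff)
next
  case (exp f)
  then obtain f' where f': "\<forall>i. f' i \<in> elementary"
    "\<And>x. (f has_derivative (\<lambda>h. \<Sum>i\<in>UNIV. f' i x * h $ i)) (at x)" by blast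
  have "((\<lambda>x. exp (f x)) has_derivative (\<lambda>h. \<Sum>i\<in>UNIV. (exp (f x) * f' i x) * h $ i)) (at x)" for x
    by (rule has_derivative_eq_rhs[OF has_derivative_compose[OF f'(2)
          DERIV_exp[unfolded has_field_derivative_def]]])
       (simp add: sum_distrib_left algebra_simps)
  then show ?case
    using f' exp.hyps
    by (intro exI[of _ "\<lambda>i x. exp (f x) * f' i x"]) (auto intro!: elementary.intros)
qed

lemma partial_deriv_eq:
  assumes "(f has_derivative (\<lambda>h. \<Sum>i\<in>UNIV. g i * h $ i)) (at x)"
  shows "partial_deriv i f x = g i"
proof -
  have "partial_deriv i f x = (\<Sum>j\<in>UNIV. g j * axis i 1 $ j)"
    using fun_cong[OF frechet_derivative_at[OF assms], of "axis i 1"] by (simp add: partial_deriv_def)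
  also have "\<dots> = g i"
    by (simp add: axis_def if_distrib cong: if_cong)
  finally show ?thesis .
qed

lemma elementary_partial_deriv:
  assumes "f \<in> elementary"
  shows "partial_deriv i f \<in> elementary"
    and "(f has_derivative (\<lambda>h. \<Sum>i\<in>UNIV. partial_deriv i f x * h $ i)) (at x)"
proof -
  obtain g where g: "\<forall>i. g i \<in> elementary"
    "\<And>x. (f has_derivative (\<lambda>h. \<Sum>i\<in>UNIV. g i x * h $ i)) (at x)"
    using elementary_gradient[OF assms] by blast
  then have eq: "partial_deriv i f = g i" for i
    by (intro ext partial_deriv_eq) blast
  show "partial_deriv i f \<in> elementary"
    "(f has_derivative (\<lambda>h. \<Sum>i\<in>UNIV. partial_deriv i f x * h $ i)) (at x)"
    using g by (simp_all add: eq)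
qed

lemma elementary_iter_partial: "f \<in> elementary \<Longrightarrow> iter_partial is f \<in> elementary"
  by (induction "is") (auto intro: elementary_partial_deriv)

lemma elementary_smooth: "f \<in> elementary \<Longrightarrow> smooth f"
  unfolding smooth_def differentiable_def
  using elementary_iter_partial elementary_partial_deriv(2) by blast

lemma elementary_continuous: "f \<in> elementary \<Longrightarrow> continuous_on S f"
  by (meson continuous_at_imp_continuous_on elementary_partial_deriv(2) has_derivative_continuous)

lemma elementary_measurable: "f \<in> elementary \<Longrightarrow> f \<in> borel_measurable borel"
  by (intro borel_measurable_continuous_onI elementary_continuous)

lemma elementary_rescale:
  fixes x :: "real ^ 'n"
  shows "f \<in> elementary \<Longrightarrow> (\<lambda>y. f ((y - x) /\<^sub>R r)) \<in> elementary"
proof (induction rule: elementary.induct)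
  case (coord i)
  show ?case
    using elementary.mult[OF elementary.const[of "inverse r"] elementary_diff[OF elementary.coord[of i] elementary.const[of "x $ i"]]]
    by (simp add: algebra_simps)
qed (auto intro: elementary.intros)

lemma partial_deriv_rescale:
  fixes x :: "real ^ 'n"
  assumes "f \<in> elementary"
  shows "partial_deriv i (\<lambda>y. c * f ((y - x) /\<^sub>R r)) = (\<lambda>y. c / r * partial_deriv i f ((y - x) /\<^sub>R r))"
proof
  fix y
  have "((\<lambda>y. (y - x) /\<^sub>R r) has_derivative (\<lambda>h. h /\<^sub>R r)) (at y)"
    by (auto intro!: derivative_eq_intros)
  from has_derivative_mult_right[OF has_derivative_compose[OF this elementary_partial_deriv(2)[OF assms]], of c]
  have "((\<lambda>y. c * f ((y - x) /\<^sub>R r)) has_derivative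
     (\<lambda>h. \<Sum>i\<in>UNIV. (c / r * partial_deriv i f ((y - x) /\<^sub>R r)) * h $ i)) (at y)"
    by (simp add: sum_distrib_left field_simps)
  then show "partial_deriv i (\<lambda>y. c * f ((y - x) /\<^sub>R r)) y = c / r * partial_deriv i f ((y - x) /\<^sub>R r)"
    by (rule partial_deriv_eq)
qed

lemma iter_partial_rescale:
  fixes x :: "real ^ 'n"
  assumes "f \<in> elementary"
  shows "iter_partial is (\<lambda>y. f ((y - x) /\<^sub>R r)) =
    (\<lambda>y. (1 / r) ^ length is * iter_partial is f ((y - x) /\<^sub>R r))"
proof (induction "is")
  case (Cons i "is")
  then show ?case
    using partial_deriv_rescale[OF elementary_iter_partial[OF assms, of "is"]] by simp
qed simp

lemma iter_partial_append: "iter_partial (is @ js) f = iter_partial is (iter_partial js f)"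
  by (induction "is") auto

section \<open>Kernels supported in the unit ball, and their dilates\<close>

definition kernel :: "(real ^ 'n \<Rightarrow> real) \<Rightarrow> bool" where
  "kernel L \<longleftrightarrow> L \<in> elementary \<and> (\<forall>x. norm x > 1 \<longrightarrow> L x = 0)"

text \<open>The strict inequality \<open>norm x > 1\<close> describes an open set, so
  \<open>L\<close> vanishes near each of its points and has derivative 0 there.\<close>

lemma kernel_partial_deriv:
  fixes L :: "real ^ 'n \<Rightarrow> real"
  assumes "kernel L"
  shows "kernel (partial_deriv i L)"
  unfolding kernel_def
proof (intro conjI allI impI)
  show "partial_deriv i L \<in> elementary"
    using assms by (auto simp: kernel_def intro: elementary_partial_deriv)
  fix x :: "real ^ 'n" assume "norm x > 1"
  have "open {x::real^'n. norm x > 1}"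
    by (intro open_Collect_less continuous_intros)
  then have "(L has_derivative (\<lambda>h. 0)) (at x)"
    using assms \<open>norm x > 1\<close>
    by (intro has_derivative_transform_within_open[OF has_derivative_const[of 0]])
       (auto simp: kernel_def)
  then show "partial_deriv i L x = 0"
    by (intro partial_deriv_eq[where g="\<lambda>_. 0"]) simp
qed

lemma kernel_iter_partial: "kernel L \<Longrightarrow> kernel (iter_partial is L)"
  by (induction "is") (auto intro: kernel_partial_deriv)

text \<open>Stability under this product and under \<open>partial_deriv\<close> lets the kernel
  change along the induction over the order of differentiation.\<close>

lemma kernel_mult_coord: "kernel L \<Longrightarrow> kernel (\<lambda>z. z $ i * L z)"
  by (auto simp: kernel_def intro: elementary.intros)

lemma kernel_bounded:
  assumes "kernel L"
  obtains m where "m \<ge> 0" "\<And>x. \<bar>L x\<bar> \<le> m"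
proof -
  have "compact (L ` cball 0 1)"
    using assms by (intro compact_continuous_image elementary_continuous) (auto simp: kernel_def)
  then obtain m where m: "\<forall>y\<in>L ` cball 0 1. norm y \<le> m"
    using compact_imp_bounded bounded_iff by metis
  have "\<bar>L x\<bar> \<le> max m 0" for x
  proof (cases "norm x > 1")
    case False
    then have "L x \<in> L ` cball 0 1" by auto
    then show ?thesis using m unfolding real_norm_def by (metis le_max_iff_disj)
  qed (use assms in \<open>auto simp: kernel_def\<close>)
  then show ?thesis
    using that[of "max m 0"] by simp
qed

lemma test_functionI:
  assumes "f \<in> elementary" "bounded {x. f x \<noteq> 0}"
  shows "test_function f"
  using assms by (simp add: test_function_def elementary_smooth compact_closure)

lemma kernel_rescale_zero:
  assumes "kernel L" "r > 0" "y \<notin> cball x r"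
  shows "L ((y - x) /\<^sub>R r) = 0"
proof -
  have "norm ((y - x) /\<^sub>R r) > 1"
    using assms unfolding norm_scaleR
    by (simp add: dist_norm norm_minus_commute field_simps del: scaleR_diff_right)
  then show ?thesis
    using assms by (auto simp: kernel_def)
qed

lemma kernel_rescale_test:
  assumes "kernel L" "r > 0"
  shows "test_function (\<lambda>y. L ((y - x) /\<^sub>R r))"
proof (rule test_functionI)
  show "(\<lambda>y. L ((y - x) /\<^sub>R r)) \<in> elementary"
    using assms by (auto simp: kernel_def intro: elementary_rescale)
  show "bounded {y. L ((y - x) /\<^sub>R r) \<noteq> 0}"
    by (rule bounded_subset[OF bounded_cball[of x r]]) (use assms kernel_rescale_zero in blast)
qed

subsection \<open>Averages against dilated kernels\<close>

text \<open>Local integrability gives measurability on compact sets; the function is the pointwise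
  limit of its truncations to the balls \<open>cball 0 n\<close>.\<close>

lemma locally_integrable_measurable:
  fixes v :: "real ^ 'n \<Rightarrow> real"
  assumes "locally_integrable v"
  shows "v \<in> borel_measurable lebesgue"
proof (rule borel_measurable_LIMSEQ_real)
  show "(\<lambda>x. indicator (cball 0 (real n)) x * v x) \<in> borel_measurable lebesgue" for n
    using assms unfolding locally_integrable_def set_integrable_def
    by (metis (no_types, lifting) borel_measurable_integrable compact_cball ext real_scaleR_def)
  fix x :: "real ^ 'n"
  obtain m :: nat where m: "norm x \<le> real m"
    using real_arch_simple by blast
  have "\<forall>\<^sub>F n in sequentially. indicator (cball 0 (real n)) x * v x = v x"
    using eventually_ge_at_top[of m] by eventually_elim (use m in \<open>auto simp: indicator_def\<close>)
  then show "(\<lambda>n. indicator (cball 0 (real n)) x * v x) \<longlonglongrightarrow> v x"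
    by (rule tendsto_eventually)
qed

lemma integrable_mult_compact_support:
  fixes v f :: "real ^ 'n \<Rightarrow> real"
  assumes v: "locally_integrable v" and K: "compact K"
    and f: "f \<in> borel_measurable lebesgue" "\<And>y. \<bar>f y\<bar> \<le> C" "\<And>y. y \<notin> K \<Longrightarrow> f y = 0"
  shows "integrable lebesgue (\<lambda>y. v y * f y)"
proof (rule Bochner_Integration.integrable_bound)
  show "integrable lebesgue (\<lambda>y. C * (indicator K y * v y))"
    using v K by (simp add: locally_integrable_def set_integrable_def)
  show "(\<lambda>y. v y * f y) \<in> borel_measurable lebesgue"
    using f(1) locally_integrable_measurable[OF v] by measurable
  show "AE y in lebesgue. norm (v y * f y) \<le> norm (C * (indicator K y * v y))"
  proof (rule AE_I2)
    fix y
    have "\<bar>f y\<bar> * \<bar>v y\<bar> \<le> \<bar>C\<bar> * \<bar>v y\<bar>"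
      using f(2)[of y] by (intro mult_right_mono) auto
    then show "norm (v y * f y) \<le> norm (C * (indicator K y * v y))"
      using f(3)[of y] by (cases "y \<in> K") (auto simp: abs_mult mult.commute)
  qed
qed

lemma locally_integrable_const: "locally_integrable (\<lambda>_. c)"
  unfolding locally_integrable_def set_integrable_def
  using lmeasurable_compact lmeasurable_iff_integrable by auto

lemma integral_rescale:
  fixes f :: "real ^ 'n \<Rightarrow> real"
  assumes f: "f \<in> borel_measurable borel" and r: "r > 0"
  shows "(LINT y|lebesgue. f ((y - x) /\<^sub>R r)) = r ^ CARD('n) * (LINT y|lebesgue. f y)"
proof -
  have "(LINT y|lebesgue. f ((y - x) /\<^sub>R r)) = (LINT y|lborel. f ((y - x) /\<^sub>R r))"
    by (intro integral_completion measurable_compose[OF _ f]) simp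
  also have "\<dots> = (LINT y|density (distr lborel borel (\<lambda>z. x + r *\<^sub>R z)) (\<lambda>_. \<bar>r ^ DIM(real^'n)\<bar>).
      f ((y - x) /\<^sub>R r))"
    using r by (subst lborel_affine[of r x]) auto
  also have "\<dots> = r ^ CARD('n) * (LINT y|lborel. f y)"
    using f r measurable_compose[OF _ f, of "\<lambda>y. (y - x) /\<^sub>R r"]
    by (subst integral_density) (auto simp: integral_distr)
  also have "(LINT y|lborel. f y) = (LINT y|lebesgue. f y)"
    using f by (simp add: integral_completion)
  finally show ?thesis .
qed

text \<open>Serves both translations and dilations of a kernel. The mean value inequality bounds the
  difference quotients by \<open>C\<close>, so \<open>C\<close> times the absolute value of
  \<open>v\<close> on \<open>K\<close> is an integrable majorant.\<close>

lemma leibniz_rule_compact_support: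
  fixes k k' :: "real \<Rightarrow> real ^ 'n \<Rightarrow> real"
  assumes v: "locally_integrable v" and K: "compact K" and t0: "t0 \<in> {a<..<b}"
    and deriv: "\<And>t y. t \<in> {a<..<b} \<Longrightarrow> ((\<lambda>t. k t y) has_real_derivative k' t y) (at t)"
    and bound': "\<And>t y. t \<in> {a<..<b} \<Longrightarrow> \<bar>k' t y\<bar> \<le> C"
    and bound: "\<And>t y. t \<in> {a<..<b} \<Longrightarrow> \<bar>k t y\<bar> \<le> C"
    and zero: "\<And>t y. t \<in> {a<..<b} \<Longrightarrow> y \<notin> K \<Longrightarrow> k t y = 0"
    and meas: "\<And>t. t \<in> {a<..<b} \<Longrightarrow> k t \<in> borel_measurable lebesgue"
    and meas': "k' t0 \<in> borel_measurable lebesgue"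
  shows "((\<lambda>t. LINT y|lebesgue. v y * k t y) has_real_derivative
      (LINT y|lebesgue. v y * k' t0 y)) (at t0)"
proof -
  let ?F = "\<lambda>t. LINT y|lebesgue. v y * k t y"
  have int: "integrable lebesgue (\<lambda>y. v y * k t y)" if "t \<in> {a<..<b}" for t
    by (rule integrable_mult_compact_support[OF v K meas]) (use that bound zero in auto)
  have vm: "v \<in> borel_measurable lebesgue"
    by (rule locally_integrable_measurable[OF v])
  have "((\<lambda>t. (?F t - ?F t0) / (t - t0)) \<longlongrightarrow> (LINT y|lebesgue. v y * k' t0 y)) (at t0 within {a<..<b})"
    unfolding tendsto_at_iff_sequentially comp_def
  proof (intro allI impI)
    fix X :: "nat \<Rightarrow> real"
    assume X: "\<forall>i. X i \<in> {a<..<b} - {t0}" "X \<longlonglongrightarrow> t0"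
    have "(\<lambda>i. LINT y|lebesgue. v y * ((k (X i) y - k t0 y) / (X i - t0)))
        \<longlonglongrightarrow> (LINT y|lebesgue. v y * k' t0 y)"
    proof (rule integral_dominated_convergence[where w="\<lambda>y. C * \<bar>indicator K y * v y\<bar>"])
      show "(\<lambda>y. v y * k' t0 y) \<in> borel_measurable lebesgue"
        using vm meas' by measurable
      show "(\<lambda>y. v y * ((k (X i) y - k t0 y) / (X i - t0))) \<in> borel_measurable lebesgue" for i
        using X(1) vm meas[of "X i"] meas[OF t0] by auto
      show "integrable lebesgue (\<lambda>y. C * \<bar>indicator K y * v y\<bar>)"
        using v K by (simp add: locally_integrable_def set_integrable_def)
      show "AE y in lebesgue. (\<lambda>i. v y * ((k (X i) y - k t0 y) / (X i - t0))) \<longlonglongrightarrow> v y * k' t0 y"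
      proof (rule AE_I2)
        fix y
        have "((\<lambda>t. (k t y - k t0 y) / (t - t0)) \<longlongrightarrow> k' t0 y) (at t0 within {a<..<b})"
          using deriv[OF t0, of y] t0
          by (simp add: has_field_derivative_iff at_within_open[OF t0])
        then have "(\<lambda>i. (k (X i) y - k t0 y) / (X i - t0)) \<longlonglongrightarrow> k' t0 y"
          using X unfolding tendsto_at_iff_sequentially comp_def by blast
        then show "(\<lambda>i. v y * ((k (X i) y - k t0 y) / (X i - t0))) \<longlonglongrightarrow> v y * k' t0 y"
          by (rule tendsto_mult_left)
      qed
      show "AE y in lebesgue. norm (v y * ((k (X i) y - k t0 y) / (X i - t0))) \<le> C * \<bar>indicator K y * v y\<bar>" for i
      proof (rule AE_I2)
        fix y
        have Xi: "X i \<in> {a<..<b}" "X i \<noteq> t0" using X(1) by auto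
        show "norm (v y * ((k (X i) y - k t0 y) / (X i - t0))) \<le> C * \<bar>indicator K y * v y\<bar>"
        proof (cases "y \<in> K")
          case True
          have "norm (k (X i) y - k t0 y) \<le> C * norm (X i - t0)"
            by (rule field_differentiable_bound[of "{a<..<b}" "\<lambda>t. k t y" "\<lambda>t. k' t y"])
               (use deriv bound' Xi t0 in \<open>auto intro: DERIV_subset\<close>)
          then have "\<bar>k (X i) y - k t0 y\<bar> / \<bar>X i - t0\<bar> \<le> C"
            using Xi by (simp add: divide_le_eq)
          then have "\<bar>v y\<bar> * (\<bar>k (X i) y - k t0 y\<bar> / \<bar>X i - t0\<bar>) \<le> \<bar>v y\<bar> * C"
            by (rule mult_left_mono) simp
          then show ?thesis
            using True by (simp add: abs_mult mult.commute)
        next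
          case False
          then show ?thesis
            using zero[OF Xi(1)] zero[OF t0] by simp
        qed
      qed
    qed
    moreover have "(LINT y|lebesgue. v y * ((k (X i) y - k t0 y) / (X i - t0))) = (?F (X i) - ?F t0) / (X i - t0)" for i
      using X(1) int[of "X i"] int[OF t0]
      by (simp add: right_diff_distrib diff_divide_distrib)
    ultimately show "(\<lambda>i. (?F (X i) - ?F t0) / (X i - t0)) \<longlonglongrightarrow> (LINT y|lebesgue. v y * k' t0 y)"
      by (simp only:)
  qed
  then show ?thesis
    using t0 by (simp add: has_field_derivative_iff at_within_open[OF t0])
qed

lemma kernel_measurable:
  fixes L :: "real ^ 'n \<Rightarrow> real"
  assumes "kernel L"
  shows "(\<lambda>y. L ((y - x) /\<^sub>R r)) \<in> borel_measurable lebesgue" "L \<in> borel_measurable borel"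
proof -
  have *: "(\<lambda>y. L ((y - x) /\<^sub>R r)) \<in> borel_measurable borel"
    using assms by (auto simp: kernel_def intro!: elementary_measurable elementary_rescale)
  show "(\<lambda>y. L ((y - x) /\<^sub>R r)) \<in> borel_measurable lebesgue"
    using * by (intro measurable_completion) simp
  show "L \<in> borel_measurable borel"
    using assms by (auto simp: kernel_def intro!: elementary_measurable)
qed

lemma integrable_kernel:
  fixes v L :: "real ^ 'n \<Rightarrow> real"
  assumes "locally_integrable v" "kernel L" "r > 0"
  shows "integrable lebesgue (\<lambda>y. v y * L ((y - x) /\<^sub>R r))"
proof -
  obtain m where "m \<ge> 0" "\<And>x. \<bar>L x\<bar> \<le> m"
    using kernel_bounded[OF assms(2)] by blast
  then show ?thesis
    using assms kernel_rescale_zero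
    by (intro integrable_mult_compact_support[OF assms(1) compact_cball[of x r], where C=m]
        kernel_measurable) auto
qed

text \<open>By translation invariance the integral of y \<mapsto> L (y + t e_i) does not depend on
  t; differentiate it under the integral at t = 0.\<close>

lemma integral_partial_deriv_kernel:
  fixes L :: "real ^ 'n \<Rightarrow> real"
  assumes L: "kernel L"
  shows "(LINT y|lebesgue. partial_deriv i L y) = 0"
proof -
  let ?e = "axis i 1 :: real ^ 'n"
  \<comment> \<open>The translate is written as a dilate at scale 1, so that the facts on rescaled
    kernels apply to it.\<close>
  let ?k = "\<lambda>t y. L ((y - (- t) *\<^sub>R ?e) /\<^sub>R 1)"
  let ?k' = "\<lambda>t y. partial_deriv i L ((y - (- t) *\<^sub>R ?e) /\<^sub>R 1)"
  obtain m1 where m1: "m1 \<ge> 0" "\<And>x. \<bar>L x\<bar> \<le> m1"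
    using kernel_bounded[OF L] by blast
  obtain m2 where m2: "m2 \<ge> 0" "\<And>x. \<bar>partial_deriv i L x\<bar> \<le> m2"
    using kernel_bounded[OF kernel_partial_deriv[OF L]] by blast
  have "((\<lambda>t. LINT y|lebesgue. 1 * ?k t y) has_real_derivative
      (LINT y|lebesgue. 1 * ?k' 0 y)) (at 0)"
  \<comment> \<open>Translations by less than 1 keep the unit ball inside
    \<open>cball 0 2\<close>.\<close>
  proof (rule leibniz_rule_compact_support[where K="cball 0 2" and a="-1" and b=1 and C="max m1 m2"])
    fix t :: real and y :: "real ^ 'n" assume t: "t \<in> {-1<..<1}"
    have "((\<lambda>t. (y - (- t) *\<^sub>R ?e) /\<^sub>R 1) has_derivative (\<lambda>h. h *\<^sub>R ?e)) (at t)"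
      by (auto intro!: derivative_eq_intros)
    from has_derivative_compose[OF this elementary_partial_deriv(2)[of L]] L
    have "((\<lambda>t. ?k t y) has_derivative
        (\<lambda>h. \<Sum>j\<in>UNIV. partial_deriv j L ((y - (- t) *\<^sub>R ?e) /\<^sub>R 1) * (h *\<^sub>R ?e) $ j)) (at t)"
      by (auto simp: kernel_def)
    moreover have "(\<Sum>j\<in>UNIV. partial_deriv j L ((y - (- t) *\<^sub>R ?e) /\<^sub>R 1) * (h *\<^sub>R ?e) $ j)
      = ?k' t y * h" for h
      by (simp add: axis_def if_distrib cong: if_cong)
    ultimately show "((\<lambda>t. ?k t y) has_real_derivative ?k' t y) (at t)"
      by (simp add: has_field_derivative_def)
    show "?k t y = 0" if "y \<notin> cball 0 2"
    proof -
      have "norm y \<le> norm ((y - (- t) *\<^sub>R ?e) /\<^sub>R 1) + norm (t *\<^sub>R ?e)"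
        using norm_triangle_ineq4[of "y + t *\<^sub>R ?e" "t *\<^sub>R ?e"] by simp
      moreover have "norm (t *\<^sub>R ?e) < 1"
        using t by auto
      ultimately have "norm ((y - (- t) *\<^sub>R ?e) /\<^sub>R 1) > 1"
        using that by auto
      then show ?thesis
        using L unfolding kernel_def by blast
    qed
    show "?k t \<in> borel_measurable lebesgue"
      by (rule kernel_measurable(1)[OF L])
  qed (use m1(2) m2(2)
      kernel_measurable(1)[OF kernel_partial_deriv[OF L], where x=0 and r=1]
      in \<open>auto simp: le_max_iff_disj locally_integrable_const simp del: scaleR_one inverse_1 minus_diff_eq\<close>)
  moreover have "(LINT y|lebesgue. 1 * ?k t y) = (LINT y|lebesgue. L y)" for t
    using integral_rescale[OF kernel_measurable(2)[OF L], of 1 "(- t) *\<^sub>R ?e"] by simp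
  ultimately have "((\<lambda>t::real. LINT y|lebesgue. L y) has_real_derivative
      (LINT y|lebesgue. partial_deriv i L y)) (at 0)"
    by simp
  then show ?thesis
    using DERIV_const DERIV_unique by blast
qed

text \<open>Convolution with the reflected kernel, dilated so that its integral is preserved. For a
  kernel of mean zero it measures oscillation rather than size.\<close>

definition dilate_avg :: "(real ^ 'n \<Rightarrow> real) \<Rightarrow> (real ^ 'n \<Rightarrow> real) \<Rightarrow> real ^ 'n \<Rightarrow> real \<Rightarrow> real" where
  "dilate_avg L v x r = (LINT y|lebesgue. v y * L ((y - x) /\<^sub>R r)) / r ^ CARD('n)"

text \<open>Euler's identity: \<open>\<partial>\<^sub>r (r\<^bsup>-N\<^esup> L (z / r))\<close> is \<open>- r\<^bsup>-N-1\<^esup>\<close> times the divergence of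
  \<open>w \<mapsto> L w *\<^sub>R w\<close> at \<open>w = z / r\<close>.\<close>

lemma dilate_avg_deriv:
  fixes v L :: "real ^ 'n \<Rightarrow> real"
  assumes v: "locally_integrable v" and L: "kernel L" and r: "r > 0"
  shows "((\<lambda>r. dilate_avg L v x r) has_real_derivative
     - (\<Sum>i\<in>UNIV. dilate_avg (partial_deriv i (\<lambda>z. z $ i * L z)) v x r) / r) (at r)"
proof -
  let ?N = "CARD('n)"
  define P where "P i = partial_deriv i (\<lambda>z. z $ i * L z)" for i
  have PK: "kernel (P i)" for i
    unfolding P_def by (intro kernel_partial_deriv kernel_mult_coord L)
  have LE: "L \<in> elementary"
    using L by (simp add: kernel_def)
  have P_eq: "P i z = L z + z $ i * partial_deriv i L z" for i z
  proof -
    have "((\<lambda>z. z $ i * L z) has_derivative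
       (\<lambda>h. \<Sum>j\<in>UNIV. ((if j = i then L z else 0) + z $ i * partial_deriv j L z) * h $ j)) (at z)"
    proof (rule has_derivative_eq_rhs[OF has_derivative_mult[OF
            bounded_linear_imp_has_derivative[OF bounded_linear_vec_nth] elementary_partial_deriv(2)[OF LE]]])
      show "(\<lambda>h. z $ i * (\<Sum>j\<in>UNIV. partial_deriv j L z * h $ j) + h $ i * L z) =
          (\<lambda>h. \<Sum>j\<in>UNIV. ((if j = i then L z else 0) + z $ i * partial_deriv j L z) * h $ j)"
        by (simp add: distrib_right sum.distrib sum_distrib_left if_distrib[where f="\<lambda>x. x * _"] mult.assoc cong: if_cong) (simp add: ac_simps)
    qed
    from partial_deriv_eq[OF this, of i] show ?thesis
      by (simp add: P_def)
  qed
  let ?k = "\<lambda>t y. L ((y - x) /\<^sub>R t) / t ^ ?N"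
  let ?k' = "\<lambda>t y. - (\<Sum>i\<in>UNIV. P i ((y - x) /\<^sub>R t)) / t ^ Suc ?N"
  obtain m1 where m1: "m1 \<ge> 0" "\<And>x. \<bar>L x\<bar> \<le> m1"
    using kernel_bounded[OF L] by blast
  have "\<forall>i. \<exists>m. \<forall>x. \<bar>P i x\<bar> \<le> m"
    using kernel_bounded[OF PK] by meson
  from choice[OF this] have "\<exists>m. \<forall>i. \<forall>x. \<bar>P i x\<bar> \<le> m i" .
  then obtain m2 where m2: "\<And>i x. \<bar>P i x\<bar> \<le> m2 i" by blast
  have m2': "\<bar>\<Sum>i\<in>UNIV. P i x\<bar> \<le> sum m2 UNIV" for x
    by (rule order_trans[OF sum_abs sum_mono]) (rule m2)
  \<comment> \<open>Scales above r/2 keep the negative powers of the scale bounded. One constant has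
    to bound both the kernel and its scale derivative.\<close>
  define C where "C = max (m1 / (r/2) ^ ?N) (sum m2 UNIV / (r/2) ^ Suc ?N)"
  have "((\<lambda>t. LINT y|lebesgue. v y * ?k t y) has_real_derivative
      (LINT y|lebesgue. v y * ?k' r y)) (at r)"
  proof (rule leibniz_rule_compact_support[OF v, where K="cball x (2*r)" and a="r/2" and b="2*r" and C="C"])
    fix t :: real and y :: "real ^ 'n" assume t: "t \<in> {r/2<..<2*r}"
    then have t0: "t > 0" using r by auto
    have "((\<lambda>t. (y - x) /\<^sub>R t) has_derivative (\<lambda>h. (- h / t\<^sup>2) *\<^sub>R (y - x))) (at t)"
      using t0 by (auto intro!: derivative_eq_intros simp: power2_eq_square field_simps)
    from has_derivative_compose[OF this elementary_partial_deriv(2)[OF LE]]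
    have "((\<lambda>t. L ((y - x) /\<^sub>R t)) has_derivative
        (\<lambda>h. \<Sum>j\<in>UNIV. partial_deriv j L ((y - x) /\<^sub>R t) * ((- h / t\<^sup>2) *\<^sub>R (y - x)) $ j)) (at t)" .
    moreover have "(\<Sum>j\<in>UNIV. partial_deriv j L ((y - x) /\<^sub>R t) * ((- h / t\<^sup>2) *\<^sub>R (y - x)) $ j)
      = - (\<Sum>j\<in>UNIV. ((y - x) /\<^sub>R t) $ j * partial_deriv j L ((y - x) /\<^sub>R t)) / t * h" for h
      using t0 by (simp add: sum_distrib_left sum_distrib_right sum_divide_distrib power2_eq_square
          flip: sum_negf) (rule sum.cong; simp add: field_simps)
    ultimately have D: "((\<lambda>t. L ((y - x) /\<^sub>R t)) has_real_derivative
        - (\<Sum>j\<in>UNIV. ((y - x) /\<^sub>R t) $ j * partial_deriv j L ((y - x) /\<^sub>R t)) / t) (at t)"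
      by (simp only: has_field_derivative_def)
    have D2: "((\<lambda>t. t ^ ?N) has_real_derivative ?N * t ^ ?N / t) (at t)"
      using t0 power_minus_mult[of ?N t] by (auto intro!: derivative_eq_intros simp: field_simps)
    define z where "z = (y - x) /\<^sub>R t"
    define S where "S = (\<Sum>j\<in>UNIV. z $ j * partial_deriv j L z)"
    \<comment> \<open>The term with \<open>?N\<close> matches the derivative of the factor
      \<open>t ^ ?N\<close>, and \<open>S\<close> that of the argument
      \<open>(y - x) /\<^sub>R t\<close>.\<close>
    have "(\<Sum>i\<in>UNIV. P i z) = real ?N * L z + S"
      by (simp add: P_eq sum.distrib S_def)
    moreover have "((- S / t) * t ^ ?N - L z * (?N * t ^ ?N / t)) / (t ^ ?N * t ^ ?N)
        = - (real ?N * L z + S) / t ^ Suc ?N"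
      using t0 by (simp add: field_simps)
    ultimately show "((\<lambda>t. ?k t y) has_real_derivative ?k' t y) (at t)"
      using DERIV_divide[OF D D2] t0 by (simp add: z_def S_def)
    have "m1 / t ^ ?N \<le> m1 / (r/2) ^ ?N" and "sum m2 UNIV / t ^ Suc ?N \<le> sum m2 UNIV / (r/2) ^ Suc ?N"
      using t r m1 m2'[of 0] by (intro divide_left_mono power_mono mult_pos_pos zero_less_power; simp)+
    moreover have "\<bar>?k t y\<bar> \<le> m1 / t ^ ?N" "\<bar>?k' t y\<bar> \<le> sum m2 UNIV / t ^ Suc ?N"
      using t0 m1(2) m2' by (simp_all add: abs_mult divide_right_mono)
    ultimately show "\<bar>?k t y\<bar> \<le> C" "\<bar>?k' t y\<bar> \<le> C"
      unfolding C_def by linarith+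
    show "?k t y = 0" if "y \<notin> cball x (2 * r)"
    proof -
      have "y \<notin> cball x t" using that t by auto
      then show ?thesis using kernel_rescale_zero[OF L t0] by simp
    qed
  qed (use L r kernel_measurable(1)[OF L] kernel_measurable(1)[OF PK] in auto)
  moreover have "(LINT y|lebesgue. v y * ?k t y) = dilate_avg L v x t" for t
    by (simp add: dilate_avg_def)
  moreover have "(LINT y|lebesgue. v y * ?k' r y) = - (\<Sum>i\<in>UNIV. dilate_avg (P i) v x r) / r"
  proof -
    have "v y * ?k' r y = (- 1 / r ^ Suc ?N) * (\<Sum>i\<in>UNIV. v y * P i ((y - x) /\<^sub>R r))" for y
      unfolding sum_distrib_left[symmetric] by simp
    then have "(LINT y|lebesgue. v y * ?k' r y) =
       (LINT y|lebesgue. (- 1 / r ^ Suc ?N) * (\<Sum>i\<in>UNIV. v y * P i ((y - x) /\<^sub>R r)))"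
      by (simp only:)
    also have "\<dots> = (- 1 / r ^ Suc ?N) * (\<Sum>i\<in>UNIV. LINT y|lebesgue. v y * P i ((y - x) /\<^sub>R r))"
      using integrable_kernel[OF v PK r]
      by (simp only: integral_mult_right_zero Bochner_Integration.integral_sum)
    also have "\<dots> = - (\<Sum>i\<in>UNIV. dilate_avg (P i) v x r) / r"
      unfolding dilate_avg_def sum_divide_distrib[symmetric] by simp
    finally show ?thesis .
  qed
  ultimately show ?thesis
    by (simp add: P_def)
qed

section \<open>Averages of weak derivatives, bounded by mean oscillation and by energy\<close>

lemma sigma_finite_lebesgue: "sigma_finite_measure (lebesgue :: 'a::euclidean_space measure)"
proof
  obtain A :: "'a set set" where A: "countable A" "A \<subseteq> sets lborel" "\<Union>A = space lborel"
      "\<forall>a\<in>A. emeasure lborel a \<noteq> \<infinity>"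
    using lborel.sigma_finite_countable by metis
  then show "\<exists>A. countable A \<and> A \<subseteq> sets lebesgue \<and> \<Union>A = space lebesgue \<and>
      (\<forall>a\<in>A. emeasure lebesgue (a :: 'a set) \<noteq> \<infinity>)"
    by (intro exI[of _ A]) (auto simp: subset_iff)
qed

lemma dilate_avg_weak_deriv:
  fixes u L :: "real ^ 'n \<Rightarrow> real"
  assumes g: "has_weak_deriv u is g" and L: "kernel L" and r: "r > 0"
  shows "dilate_avg L g x r = (- 1 / r) ^ length is * dilate_avg (iter_partial is L) u x r"
proof -
  let ?n = "length is"
  have "(LINT y|lebesgue. u y * ((1 / r) ^ ?n * iter_partial is L ((y - x) /\<^sub>R r))) =
      (- 1) ^ ?n * (LINT y|lebesgue. g y * L ((y - x) /\<^sub>R r))"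
  proof -
    have "(LINT y|lebesgue. u y * iter_partial is (\<lambda>y. L ((y - x) /\<^sub>R r)) y) =
        (- 1) ^ ?n * (LINT y|lebesgue. g y * L ((y - x) /\<^sub>R r))"
      using g kernel_rescale_test[OF L r, of x] by (simp only: has_weak_deriv_def)
    then show ?thesis
      using L by (simp only: iter_partial_rescale[of L] kernel_def)
  qed
  moreover have "(LINT y|lebesgue. u y * ((1 / r) ^ ?n * iter_partial is L ((y - x) /\<^sub>R r))) =
      (1 / r) ^ ?n * (LINT y|lebesgue. u y * iter_partial is L ((y - x) /\<^sub>R r))"
    by (simp only: mult.left_commute[of "u _"] integral_mult_right_zero)
  ultimately have "(- 1) ^ ?n * ((- 1) ^ ?n * (LINT y|lebesgue. g y * L ((y - x) /\<^sub>R r))) =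
      (- 1) ^ ?n * ((1 / r) ^ ?n * (LINT y|lebesgue. u y * iter_partial is L ((y - x) /\<^sub>R r)))"
    by simp
  then have "(LINT y|lebesgue. g y * L ((y - x) /\<^sub>R r)) =
      (- 1 / r) ^ ?n * (LINT y|lebesgue. u y * iter_partial is L ((y - x) /\<^sub>R r))"
    by (simp flip: mult.assoc power_mult_distrib)
  then show ?thesis
    by (simp add: dilate_avg_def)
qed

lemma has_weak_deriv_locally_integrable:
  "has_weak_deriv u is g \<Longrightarrow> locally_integrable u"
  "has_weak_deriv u is g \<Longrightarrow> locally_integrable g"
  by (simp_all add: has_weak_deriv_def)

text \<open>The scale derivative puts one more partial derivative on \<open>z $ i * L z\<close>.
  Reducing both sides to averages of \<open>u\<close> shows that this derivative can be counted on
  \<open>u\<close> instead. The new index goes last in \<open>is @ [i]\<close> because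
  \<open>iter_partial\<close> applies the last index to the kernel first.\<close>

lemma dilate_avg_deriv_weak:
  fixes u L :: "real ^ 'n \<Rightarrow> real"
  assumes v: "has_weak_deriv u is v" and v': "\<And>i. has_weak_deriv u (is @ [i]) (v' i)"
    and L: "kernel L" and r: "r > 0"
  shows "((\<lambda>r. dilate_avg L v x r) has_real_derivative
      (\<Sum>i\<in>UNIV. dilate_avg (\<lambda>z. z $ i * L z) (v' i) x r)) (at r)"
proof -
  have "- dilate_avg (partial_deriv i (\<lambda>z. z $ i * L z)) v x r / r =
      dilate_avg (\<lambda>z. z $ i * L z) (v' i) x r" for i
    by (simp add: dilate_avg_weak_deriv[OF v' kernel_mult_coord[OF L] r] iter_partial_append
        dilate_avg_weak_deriv[OF v kernel_partial_deriv[OF kernel_mult_coord[OF L]] r])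
  then have "(\<Sum>i\<in>UNIV. - dilate_avg (partial_deriv i (\<lambda>z. z $ i * L z)) v x r / r) =
      (\<Sum>i\<in>UNIV. dilate_avg (\<lambda>z. z $ i * L z) (v' i) x r)"
    by (intro sum.cong) auto
  then show ?thesis
    using dilate_avg_deriv[OF has_weak_deriv_locally_integrable(2)[OF v] L r, of x]
    by (simp add: sum_negf sum_divide_distrib)
qed

text \<open>Since \<open>M\<close> has mean zero, the constant \<open>u y\<close> may be subtracted
  from \<open>u\<close> for each y in the ball. Integrating the resulting bound over y produces the
  double integral of the mean oscillation.\<close>

lemma dilate_avg_bmo:
  fixes u M :: "real ^ 'n \<Rightarrow> real"
  assumes u: "locally_integrable u" and osc: "bmo_oscillation u \<le> ennreal b" and b: "b \<ge> 0"
    and M: "kernel M" "(LINT y|lebesgue. M y) = 0" and m: "m \<ge> 0" "\<And>y. \<bar>M y\<bar> \<le> m"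
    and r: "r > 0"
  shows "\<bar>dilate_avg M u x r\<bar> \<le> m * (2 ^ CARD('n) * unit_ball_vol (real CARD('n))) * b"
proof -
  \<comment> \<open>The dilated kernel lives on a closed ball of radius r, while oscillation is
    measured on open balls; doubling the radius is the source of the factor 2^N.\<close>
  define B where "B = ball x (2 * r)"
  define V where "V = measure lebesgue B"
  define I where "I = (LINT z|lebesgue. u z * M ((z - x) /\<^sub>R r))"
  have V: "V > 0" "V = r ^ CARD('n) * (2 ^ CARD('n) * unit_ball_vol (real CARD('n)))"
    using content_ball[of "2*r" x] r by (simp_all add: V_def B_def power_mult_distrib)
  have B: "B \<in> sets lebesgue" "emeasure lebesgue B = ennreal V"
    using r content_ball[of "2*r" x] by (simp_all add: B_def V_def emeasure_ball)
  have [measurable]: "u \<in> borel_measurable lebesgue"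
    by (rule locally_integrable_measurable[OF u])
  have pointwise: "ennreal \<bar>I\<bar> \<le> ennreal m * (\<integral>\<^sup>+ z \<in> B. ennreal \<bar>u y - u z\<bar> \<partial>lebesgue)" for y
  proof -
    have "(LINT z|lebesgue. u y * M ((z - x) /\<^sub>R r)) = 0"
      using integral_rescale[OF kernel_measurable(2)[OF M(1)] r, of x] M(2) by simp
    moreover have int: "integrable lebesgue (\<lambda>z. u y * M ((z - x) /\<^sub>R r))"
      "integrable lebesgue (\<lambda>z. u z * M ((z - x) /\<^sub>R r))"
      using integrable_kernel[OF locally_integrable_const M(1) r] integrable_kernel[OF u M(1) r] by auto
    ultimately have "I = (LINT z|lebesgue. u z * M ((z - x) /\<^sub>R r) - u y * M ((z - x) /\<^sub>R r))"
      unfolding I_def by (subst Bochner_Integration.integral_diff) auto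
    then have "ennreal \<bar>I\<bar> \<le> (\<integral>\<^sup>+ z. ennreal (norm (u z * M ((z - x) /\<^sub>R r) - u y * M ((z - x) /\<^sub>R r))) \<partial>lebesgue)"
      using integral_norm_bound_ennreal[OF Bochner_Integration.integrable_diff[OF int(2) int(1)]] by simp
    also have "\<dots> \<le> (\<integral>\<^sup>+ z. ennreal m * (ennreal \<bar>u y - u z\<bar> * indicator B z) \<partial>lebesgue)"
    proof (rule nn_integral_mono)
      fix z
      show "ennreal (norm (u z * M ((z - x) /\<^sub>R r) - u y * M ((z - x) /\<^sub>R r)))
        \<le> ennreal m * (ennreal \<bar>u y - u z\<bar> * indicator B z)"
      proof (cases "z \<in> B")
        case True
        have "norm (u z * M ((z - x) /\<^sub>R r) - u y * M ((z - x) /\<^sub>R r)) = \<bar>M ((z - x) /\<^sub>R r)\<bar> * \<bar>u y - u z\<bar>"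
          unfolding left_diff_distrib[symmetric] by (simp add: abs_mult abs_minus_commute)
        also have "\<dots> \<le> m * \<bar>u y - u z\<bar>"
          by (intro mult_right_mono m) auto
        finally show ?thesis
          using True m by (simp add: ennreal_leI flip: ennreal_mult)
      next
        case False
        then have "M ((z - x) /\<^sub>R r) = 0"
          using r by (intro kernel_rescale_zero M) (auto simp: B_def)
        then show ?thesis by simp
      qed
    qed
    also have "\<dots> = ennreal m * (\<integral>\<^sup>+ z \<in> B. ennreal \<bar>u y - u z\<bar> \<partial>lebesgue)"
      using B by (subst nn_integral_cmult) auto
    finally show ?thesis .
  qed
  define T where "T = (\<integral>\<^sup>+ y \<in> B. (\<integral>\<^sup>+ z \<in> B. ennreal \<bar>u y - u z\<bar> \<partial>lebesgue) \<partial>lebesgue)"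
  have "T / (ennreal V)\<^sup>2 \<le> bmo_oscillation u"
    unfolding bmo_oscillation_def T_def B(2)[symmetric] mean_oscillation_def[symmetric] B_def
    using r by (intro SUP_upper2[of x] SUP_upper2[of "2*r"]) auto
  then have "T / (ennreal V)\<^sup>2 \<le> ennreal b"
    using osc by simp
  then have "T / (ennreal V)\<^sup>2 * (ennreal V)\<^sup>2 \<le> ennreal b * (ennreal V)\<^sup>2"
    by (rule mult_right_mono) simp
  moreover have "(ennreal V)\<^sup>2 = ennreal (V\<^sup>2)"
    using V(1) by (simp add: ennreal_power)
  moreover have "T / ennreal (V\<^sup>2) * ennreal (V\<^sup>2) = T"
    using V(1) by (simp add: ennreal_divide_times ennreal_times_divide ennreal_mult_divide_eq)
  ultimately have T: "T \<le> ennreal (b * V\<^sup>2)"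
    using b by (simp add: ennreal_mult)
  \<comment> \<open>\<open>I\<close> does not depend on y, so integrating over \<open>B\<close>
    gains a factor \<open>V\<close> on the left. Against T <= b V^2 this leaves a single
    \<open>V\<close>, which is a multiple of r^N.\<close>
  have "ennreal (\<bar>I\<bar> * V) = (\<integral>\<^sup>+ y. ennreal \<bar>I\<bar> * indicator B y \<partial>lebesgue)"
    using B V(1) by (subst nn_integral_cmult_indicator) (auto simp: ennreal_mult)
  also have "\<dots> \<le> (\<integral>\<^sup>+ y. ennreal m * ((\<integral>\<^sup>+ z \<in> B. ennreal \<bar>u y - u z\<bar> \<partial>lebesgue) * indicator B y) \<partial>lebesgue)"
    using pointwise by (intro nn_integral_mono) (auto simp: indicator_def)
  also have "\<dots> = ennreal m * T"
  proof -
    have "(\<lambda>y. \<integral>\<^sup>+ z. ennreal \<bar>u y - u z\<bar> * indicator B z \<partial>lebesgue) \<in> borel_measurable lebesgue"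
    proof -
      have "(\<lambda>(y, z). ennreal \<bar>u y - u z\<bar> * indicator B z) \<in> borel_measurable (lebesgue \<Otimes>\<^sub>M lebesgue)"
        using B(1) by measurable
      then show ?thesis
        using sigma_finite_measure.borel_measurable_nn_integral[of lebesgue "\<lambda>y z. ennreal \<bar>u y - u z\<bar> * indicator B z" lebesgue]
          sigma_finite_lebesgue[where 'a="real^'n"] by auto
    qed
    then show ?thesis
      unfolding T_def using B(1) by (intro nn_integral_cmult borel_measurable_times_ennreal borel_measurable_indicator)
  qed
  also have "\<dots> \<le> ennreal m * ennreal (b * V\<^sup>2)"
    by (intro mult_left_mono T) simp
  finally have "\<bar>I\<bar> * V \<le> m * (b * V\<^sup>2)"
    using m b by (simp flip: ennreal_mult)
  then have "\<bar>I\<bar> \<le> m * b * V"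
    using V(1) by (simp add: power2_eq_square)
  then have "\<bar>I\<bar> / r ^ CARD('n) \<le> m * b * V / r ^ CARD('n)"
    using r by (intro divide_right_mono) auto
  then show ?thesis
    using r V(2) by (simp add: dilate_avg_def I_def mult.assoc mult.commute mult.left_commute)
qed

text \<open>At least one derivative falls on the kernel, which makes its integral vanish.
  \<open>C\<close> is chosen before \<open>u\<close>, \<open>b\<close>, \<open>x\<close> and
  \<open>r\<close> because the final constant must serve every \<open>u\<close>.\<close>

lemma dilate_avg_weak_deriv_bmo:
  fixes L :: "real ^ 'n \<Rightarrow> real"
  assumes L: "kernel L" and "is \<noteq> []"
  shows "\<exists>C\<ge>0. \<forall>u g b x r. has_weak_deriv u is g \<longrightarrow> bmo_oscillation u \<le> ennreal b \<longrightarrow> b \<ge> 0 \<longrightarrow> r > 0 \<longrightarrow>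
    \<bar>dilate_avg L g x r\<bar> \<le> C * (b / r ^ length is)"
proof -
  have K: "kernel (iter_partial is L)"
    by (rule kernel_iter_partial[OF L])
  obtain m where m: "m \<ge> 0" "\<And>x. \<bar>iter_partial is L x\<bar> \<le> m"
    using kernel_bounded[OF K] by blast
  have z: "(LINT y|lebesgue. iter_partial is L y) = 0"
    using \<open>is \<noteq> []\<close> integral_partial_deriv_kernel[OF kernel_iter_partial[OF L]]
    by (cases "is") auto
  let ?C = "m * (2 ^ CARD('n) * unit_ball_vol (real CARD('n)))"
  have "\<bar>dilate_avg L g x r\<bar> \<le> ?C * (b / r ^ length is)"
    if "has_weak_deriv u is g" "bmo_oscillation u \<le> ennreal b" "b \<ge> 0" "r > 0" for u g b x r
  proof -
    have "\<bar>dilate_avg L g x r\<bar> = \<bar>dilate_avg (iter_partial is L) u x r\<bar> / r ^ length is"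
      using that by (simp add: dilate_avg_weak_deriv[OF that(1) L that(4)] abs_mult power_abs power_divide)
    also have "\<dots> \<le> ?C * b / r ^ length is"
      using that dilate_avg_bmo[OF has_weak_deriv_locally_integrable(1) _ _ K z m, of u "is" g b r x]
      by (intro divide_right_mono) auto
    finally show ?thesis by simp
  qed
  moreover have "?C \<ge> 0" using m by simp
  ultimately show ?thesis by blast
qed

text \<open>The difference is an average of \<open>v y - v x\<close>. On the support of the dilated
  kernel the distance from y to x is at most r, so inserting the singular weight of the energy costs
  at most \<open>r powr (N + \<sigma> * p)\<close>.\<close>

lemma dilate_avg_gagliardo:
  fixes v L :: "real ^ 'n \<Rightarrow> real"
  assumes v: "locally_integrable v" and L: "kernel L" and m: "m \<ge> 0" "\<And>y. \<bar>L y\<bar> \<le> m"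
    and p: "p \<ge> 1" and \<sigma>: "\<sigma> > 0" and g: "g > 0" and r: "r > 0"
    and le: "(\<integral>\<^sup>+ y. ennreal (\<bar>v y - v x\<bar> powr p / norm (y - x) powr (real CARD('n) + \<sigma> * p)) \<partial>lebesgue)
      \<le> ennreal (g powr p)"
  shows "\<bar>dilate_avg L v x r - (LINT y|lebesgue. L y) * v x\<bar>
    \<le> m * (unit_ball_vol (real CARD('n)) + 1) * (r powr \<sigma> * g)"
proof -
  let ?N = "CARD('n)"
  let ?B = "cball x r"
  define V where "V = unit_ball_vol (real CARD('n))"
  define a where "a = r powr \<sigma> * g"
  define c where "c = a powr (1 - p) * r powr (?N + \<sigma> * p)"
  define J where "J = (LINT y|lebesgue. (v y - v x) * L ((y - x) /\<^sub>R r))"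
  have a: "a > 0" using r g by (simp add: a_def)
  have c: "c \<ge> 0" by (simp add: c_def)
  have [measurable]: "v \<in> borel_measurable lebesgue"
    by (rule locally_integrable_measurable[OF v])
  have [measurable]: "(\<lambda>y. norm (y - x)) \<in> borel_measurable lebesgue"
    by (intro measurable_completion) simp
  have B: "?B \<in> sets lebesgue" "emeasure lebesgue ?B = ennreal (r ^ ?N * V)"
    using emeasure_cball[of r x] r by (simp_all add: V_def mult.commute)
  have V: "V \<ge> 0"
    by (simp add: V_def)
  have int: "integrable lebesgue (\<lambda>y. v y * L ((y - x) /\<^sub>R r))"
    "integrable lebesgue (\<lambda>y. v x * L ((y - x) /\<^sub>R r))"
    using integrable_kernel[OF locally_integrable_const L r] integrable_kernel[OF v L r] by auto
  have J_eq: "J / r ^ ?N = dilate_avg L v x r - (LINT y|lebesgue. L y) * v x"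
    using int integral_rescale[OF kernel_measurable(2)[OF L] r, of x] r
    by (simp add: J_def dilate_avg_def left_diff_distrib diff_divide_distrib)
  \<comment> \<open>Replaces Hoelder's inequality: optimal for \<open>a\<close> the expected size of the average.\<close>
  have young: "t \<le> a + a powr (1 - p) * t powr p" if "t \<ge> 0" for t
  proof (cases "t \<le> a")
    case False
    have "t = t powr (1 - p) * t powr p"
      using False a by (simp flip: powr_add)
    also have "\<dots> \<le> a powr (1 - p) * t powr p"
      using False a p by (intro mult_right_mono powr_mono2') auto
    finally show ?thesis using a by simp
  qed (simp add: add_increasing2)
  have "ennreal \<bar>J\<bar> \<le> (\<integral>\<^sup>+ y. ennreal (norm ((v y - v x) * L ((y - x) /\<^sub>R r))) \<partial>lebesgue)"
    using integral_norm_bound_ennreal[OF Bochner_Integration.integrable_diff[OF int]]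
    by (simp add: J_def left_diff_distrib)
  also have "\<dots> \<le> (\<integral>\<^sup>+ y. ennreal (m * a) * indicator ?B y +
      ennreal (m * c) * ennreal (\<bar>v y - v x\<bar> powr p / norm (y - x) powr (?N + \<sigma> * p)) \<partial>lebesgue)"
  proof (rule nn_integral_mono)
    fix y
    show "ennreal (norm ((v y - v x) * L ((y - x) /\<^sub>R r))) \<le> ennreal (m * a) * indicator ?B y +
      ennreal (m * c) * ennreal (\<bar>v y - v x\<bar> powr p / norm (y - x) powr (?N + \<sigma> * p))"
    proof (cases "y \<in> ?B")
      case True
      have "\<bar>v y - v x\<bar> powr p \<le> r powr (?N + \<sigma> * p) * (\<bar>v y - v x\<bar> powr p / norm (y - x) powr (?N + \<sigma> * p))"
      proof (cases "y = x")
        case False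
        have "norm (y - x) powr (?N + \<sigma> * p) \<le> r powr (?N + \<sigma> * p)"
          using True p \<sigma> by (intro powr_mono2) (auto simp: dist_norm norm_minus_commute)
        then have "\<bar>v y - v x\<bar> powr p * norm (y - x) powr (?N + \<sigma> * p) \<le> \<bar>v y - v x\<bar> powr p * r powr (?N + \<sigma> * p)"
          by (rule mult_left_mono) simp
        then show ?thesis
          using False by (simp add: field_simps)
      qed simp
      then have "a powr (1 - p) * \<bar>v y - v x\<bar> powr p \<le>
          c * (\<bar>v y - v x\<bar> powr p / norm (y - x) powr (?N + \<sigma> * p))"
        unfolding c_def mult.assoc by (rule mult_left_mono) simp
      then have "\<bar>v y - v x\<bar> \<le> a + c * (\<bar>v y - v x\<bar> powr p / norm (y - x) powr (?N + \<sigma> * p))"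
        using young[of "\<bar>v y - v x\<bar>"] by simp
      then have "\<bar>v y - v x\<bar> * \<bar>L ((y - x) /\<^sub>R r)\<bar> \<le>
          (a + c * (\<bar>v y - v x\<bar> powr p / norm (y - x) powr (?N + \<sigma> * p))) * m"
        using m a c by (intro mult_mono) auto
      then have "norm ((v y - v x) * L ((y - x) /\<^sub>R r)) \<le>
          m * a + m * c * (\<bar>v y - v x\<bar> powr p / norm (y - x) powr (?N + \<sigma> * p))"
        unfolding real_norm_def abs_mult by (simp only: algebra_simps)
      then show ?thesis
        using True m a c by (simp add: ennreal_leI flip: ennreal_mult ennreal_plus)
    next
      case False
      then have "L ((y - x) /\<^sub>R r) = 0"
        by (intro kernel_rescale_zero L r)
      then show ?thesis by simp
    qed
  qed
  also have "\<dots> = ennreal (m * a) * ennreal (r ^ ?N * V) + ennreal (m * c) *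
      (\<integral>\<^sup>+ y. ennreal (\<bar>v y - v x\<bar> powr p / norm (y - x) powr (real CARD('n) + \<sigma> * p)) \<partial>lebesgue)"
    using B by (subst nn_integral_add)
      (auto simp: nn_integral_cmult nn_integral_cmult_indicator
        intro!: borel_measurable_times_ennreal borel_measurable_indicator)
  also have "\<dots> \<le> ennreal (m * a) * ennreal (r ^ ?N * V) + ennreal (m * c) * ennreal (g powr p)"
    by (intro add_left_mono mult_left_mono le) simp
  also have "\<dots> = ennreal (m * a * (r ^ ?N * V) + m * c * g powr p)"
    using m a c r V by (simp flip: ennreal_mult ennreal_plus)
  finally have "ennreal \<bar>J\<bar> \<le> ennreal (m * a * (r ^ ?N * V) + m * c * g powr p)" .
  then have "\<bar>J\<bar> \<le> m * a * (r ^ ?N * V) + m * c * g powr p"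
    by (subst (asm) ennreal_le_iff) (use m a c r V in auto)
  \<comment> \<open>For this choice of \<open>a\<close> the energy term has the size r^N a, just
    like the term integrated over the ball. It contributes the summand 1 beside the volume in the
    constant.\<close>
  moreover have "c * g powr p = r ^ ?N * a"
  proof -
    have "r powr (?N + \<sigma> * p) * g powr p = r ^ ?N * a powr p"
      using r g by (simp add: a_def powr_add powr_mult powr_powr powr_realpow)
    then have "c * g powr p = r ^ ?N * (a powr (1 - p) * a powr p)"
      by (simp add: c_def)
    then show ?thesis
      using a by (simp flip: powr_add)
  qed
  moreover have "m * c * g powr p = m * (c * g powr p)"
    by (rule mult.assoc)
  ultimately have "\<bar>J\<bar> \<le> m * (V + 1) * a * r ^ ?N"
    by (simp only:) (simp add: algebra_simps)
  then have "\<bar>J / r ^ ?N\<bar> \<le> m * (V + 1) * a"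
    using r by (simp add: divide_le_eq)
  then show ?thesis
    by (simp add: J_eq a_def V_def)
qed

subsection \<open>Interpolation between oscillation and fractional energy\<close>

definition gagliardo_density :: "nat \<Rightarrow> real \<Rightarrow> real \<Rightarrow> (real ^ 'n \<Rightarrow> real) \<Rightarrow> real ^ 'n \<Rightarrow> ennreal" where
  "gagliardo_density k \<sigma> p u x = (\<integral>\<^sup>+ y.
     ennreal (tensor_norm k (\<lambda>is. weak_deriv u is y - weak_deriv u is x) powr p /
       norm (y - x) powr (real CARD('n) + \<sigma> * p)) \<partial>lebesgue)"

text \<open>Strictly positive majorants \<open>b\<close> and \<open>g\<close> avoid the degenerate cases of a vanishing
  semi-norm; they are made sharp by a limit.\<close>

definition controlled :: "nat \<Rightarrow> real \<Rightarrow> real \<Rightarrow> (real ^ 'n \<Rightarrow> real) \<Rightarrow> real \<Rightarrow> real ^ 'n \<Rightarrow> real \<Rightarrow> bool" where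
  "controlled k \<sigma> p u b x g \<longleftrightarrow>
     (\<forall>is. length is \<le> k \<longrightarrow> has_weak_deriv u is (weak_deriv u is)) \<and>
     b > 0 \<and> bmo_oscillation u \<le> ennreal b \<and>
     g > 0 \<and> gagliardo_density k \<sigma> p u x \<le> ennreal (g powr p)"

lemma finite_lists_length: "finite {is :: 'n::finite list. length is = j}"
  using finite_lists_length_eq[of "UNIV :: 'n set" j] by simp

lemma component_le_tensor_norm:
  fixes T :: "'n::finite list \<Rightarrow> real"
  assumes "length is = j"
  shows "\<bar>T is\<bar> \<le> tensor_norm j T"
proof -
  have "\<bar>T is\<bar> = L2_set T {is}"
    by simp
  also have "\<dots> \<le> tensor_norm j T"
    unfolding tensor_norm_def L2_set_def
    using assms by (intro real_sqrt_le_mono sum_mono2 finite_lists_length) auto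
  finally show ?thesis .
qed

text \<open>Both averages are compared with the same number, the integral of \<open>L\<close> times
  the value of the weak derivative at x. It cancels, and the two errors give the factor 2.\<close>

lemma dilate_avg_oscillation_top:
  fixes L :: "real ^ 'n \<Rightarrow> real"
  assumes p: "p \<ge> 1" and \<sigma>: "\<sigma> > 0" and L: "kernel L" and len: "length is = k"
  shows "\<exists>C\<ge>0. \<forall>u b x g \<rho> r. controlled k \<sigma> p u b x g \<longrightarrow> 0 < \<rho> \<longrightarrow> \<rho> \<le> r \<longrightarrow>
    \<bar>dilate_avg L (weak_deriv u is) x \<rho> - dilate_avg L (weak_deriv u is) x r\<bar> \<le> C * (r powr \<sigma> * g)"
proof -
  obtain m where m: "m \<ge> 0" "\<And>y. \<bar>L y\<bar> \<le> m"
    using kernel_bounded[OF L] by blast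
  define c where "c = m * (unit_ball_vol (real CARD('n)) + 1)"
  have c: "c \<ge> 0"
    using m by (simp add: c_def)
  have "\<bar>dilate_avg L (weak_deriv u is) x \<rho> - dilate_avg L (weak_deriv u is) x r\<bar> \<le> 2 * c * (r powr \<sigma> * g)"
    if ctl: "controlled k \<sigma> p u b x g" and \<rho>: "0 < \<rho>" "\<rho> \<le> r" for u b x g \<rho> r
  proof -
    let ?v = "weak_deriv u is"
    have v: "locally_integrable ?v"
      using ctl len has_weak_deriv_locally_integrable(2)[of u "is"] by (simp add: controlled_def)
    have g: "g > 0" using ctl by (simp add: controlled_def)
    have "(\<integral>\<^sup>+ y. ennreal (\<bar>?v y - ?v x\<bar> powr p / norm (y - x) powr (real CARD('n) + \<sigma> * p)) \<partial>lebesgue)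
        \<le> gagliardo_density k \<sigma> p u x"
      unfolding gagliardo_density_def
      using p by (intro nn_integral_mono ennreal_leI divide_right_mono powr_mono2
          component_le_tensor_norm[OF len, where T="\<lambda>is. weak_deriv u is _ - weak_deriv u is x"]) auto
    also have "\<dots> \<le> ennreal (g powr p)"
      using ctl by (simp add: controlled_def)
    finally have *: "\<bar>dilate_avg L ?v x t - (LINT y|lebesgue. L y) * ?v x\<bar> \<le> c * (t powr \<sigma> * g)" if "t > 0" for t
      unfolding c_def by (intro dilate_avg_gagliardo[OF v L m p \<sigma> g that])
    have "\<rho> powr \<sigma> * g \<le> r powr \<sigma> * g"
      using \<rho> \<sigma> g by (intro mult_right_mono powr_mono2) auto
    then have "c * (\<rho> powr \<sigma> * g) \<le> c * (r powr \<sigma> * g)"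
      using c by (rule mult_left_mono)
    then show ?thesis
      using *[of \<rho>] *[of r] \<rho> by linarith
  qed
  moreover have "2 * c \<ge> 0" using c by simp
  ultimately show ?thesis by blast
qed

text \<open>An interval of scales ending at r has length at most r, so passing from order j + 1 to
  order j costs one factor r.\<close>

lemma dilate_avg_mvt:
  fixes L u :: "real ^ 'n \<Rightarrow> real"
  assumes v: "has_weak_deriv u is v" and v': "\<And>i. has_weak_deriv u (is @ [i]) (v' i)"
    and L: "kernel L" and r: "0 < \<rho>" "\<rho> \<le> r"
    and bound: "\<And>i t. t \<in> {\<rho>..r} \<Longrightarrow> \<bar>dilate_avg (\<lambda>z. z $ i * L z) (v' i) x t\<bar> \<le> B i"
  shows "\<bar>dilate_avg L v x \<rho> - dilate_avg L v x r\<bar> \<le> r * (\<Sum>i\<in>UNIV. B i)"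
proof -
  have "norm (dilate_avg L v x \<rho> - dilate_avg L v x r) \<le> (\<Sum>i\<in>UNIV. B i) * norm (\<rho> - r)"
  proof (rule field_differentiable_bound[of "{\<rho>..r}"])
    fix t assume t: "t \<in> {\<rho>..r}"
    then show "(dilate_avg L v x has_field_derivative
        (\<Sum>i\<in>UNIV. dilate_avg (\<lambda>z. z $ i * L z) (v' i) x t)) (at t within {\<rho>..r})"
      using r by (intro DERIV_subset[OF dilate_avg_deriv_weak[OF v v' L]]) auto
    show "norm (\<Sum>i\<in>UNIV. dilate_avg (\<lambda>z. z $ i * L z) (v' i) x t) \<le> (\<Sum>i\<in>UNIV. B i)"
      unfolding real_norm_def by (rule order_trans[OF sum_abs sum_mono]) (rule bound[OF t])
  qed (use r in auto)
  also have "\<dots> \<le> (\<Sum>i\<in>UNIV. B i) * r"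
  proof (rule mult_left_mono)
    show "(\<Sum>i\<in>UNIV. B i) \<ge> 0"
      using r by (intro sum_nonneg order_trans[OF abs_ge_zero bound[of \<rho>]]) auto
  qed (use r in auto)
  finally show ?thesis
    by (simp add: mult.commute)
qed

text \<open>Induction on k - j, from the top order downwards. Kernel and list are arbitrary because
  the step passes to \<open>z $ i * L z\<close> and \<open>is @ [i]\<close>. The bound involves the
  larger scale only, so nothing blows up as \<rho> tends to 0.\<close>

lemma dilate_avg_oscillation:
  fixes L :: "real ^ 'n \<Rightarrow> real"
  assumes p: "p \<ge> 1" and \<sigma>: "\<sigma> > 0"
  shows "kernel L \<Longrightarrow> length is = j \<Longrightarrow> j \<le> k \<Longrightarrow>
    \<exists>C\<ge>0. \<forall>u b x g \<rho> r. controlled k \<sigma> p u b x g \<longrightarrow> 0 < \<rho> \<longrightarrow> \<rho> \<le> r \<longrightarrow>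
    \<bar>dilate_avg L (weak_deriv u is) x \<rho> - dilate_avg L (weak_deriv u is) x r\<bar>
      \<le> C * (b / r ^ j + r powr (real k + \<sigma> - real j) * g)"
proof (induction "k - j" arbitrary: j "is" L)
  case 0
  then have jk: "j = k" by simp
  obtain C where C: "C \<ge> 0" "\<And>u b x g \<rho> r. controlled k \<sigma> p u b x g \<Longrightarrow> 0 < \<rho> \<Longrightarrow> \<rho> \<le> r \<Longrightarrow>
    \<bar>dilate_avg L (weak_deriv u is) x \<rho> - dilate_avg L (weak_deriv u is) x r\<bar> \<le> C * (r powr \<sigma> * g)"
    using dilate_avg_oscillation_top[OF p \<sigma> 0(2), of "is" k] 0 jk by blast
  show ?case
  proof (intro exI[of _ C] conjI allI impI C(1))
    fix u :: "real ^ 'n \<Rightarrow> real" and b g \<rho> r :: real and x assume as: "controlled k \<sigma> p u b x g" "0 < \<rho>" "\<rho> \<le> (r::real)"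
    have "b / r ^ j \<ge> 0" using as by (simp add: controlled_def)
    then have "C * (r powr \<sigma> * g) \<le> C * (b / r ^ j + r powr (real k + \<sigma> - real j) * g)"
      using C(1) jk by (intro mult_left_mono) auto
    then show "\<bar>dilate_avg L (weak_deriv u is) x \<rho> - dilate_avg L (weak_deriv u is) x r\<bar>
      \<le> C * (b / r ^ j + r powr (real k + \<sigma> - real j) * g)"
      using C(2)[OF as] by linarith
  qed
next
  case (Suc d)
  let ?M = "\<lambda>i z. z $ i * L z"
  \<comment> \<open>At order j + 1 the average at scale t is its value at scale r, bounded by the
    oscillation of \<open>u\<close>, plus the variation between t and r, bounded by the induction
    hypothesis.\<close>
  have "\<exists>C\<ge>0. \<forall>u b x g t r. controlled k \<sigma> p u b x g \<longrightarrow> 0 < t \<longrightarrow> t \<le> r \<longrightarrow>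
      \<bar>dilate_avg (?M i) (weak_deriv u (is @ [i])) x t\<bar>
        \<le> C * (b / r ^ Suc j + r powr (real k + \<sigma> - real (Suc j)) * g)" for i
  proof -
    have K: "kernel (?M i)"
      by (rule kernel_mult_coord[OF Suc.prems(1)])
    obtain C1 where C1: "C1 \<ge> 0" "\<And>u b x g \<rho> r. controlled k \<sigma> p u b x g \<Longrightarrow> 0 < \<rho> \<Longrightarrow> \<rho> \<le> r \<Longrightarrow>
      \<bar>dilate_avg (?M i) (weak_deriv u (is @ [i])) x \<rho> - dilate_avg (?M i) (weak_deriv u (is @ [i])) x r\<bar>
        \<le> C1 * (b / r ^ Suc j + r powr (real k + \<sigma> - real (Suc j)) * g)"
      using Suc.hyps(1)[of "Suc j" "?M i" "is @ [i]"] K Suc.hyps(2) Suc.prems by fastforce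
    obtain C2 where C2: "C2 \<ge> 0" "\<And>u g b x r. has_weak_deriv u (is @ [i]) g \<Longrightarrow> bmo_oscillation u \<le> ennreal b \<Longrightarrow>
      b \<ge> 0 \<Longrightarrow> r > 0 \<Longrightarrow> \<bar>dilate_avg (?M i) g x r\<bar> \<le> C2 * (b / r ^ length (is @ [i]))"
      using dilate_avg_weak_deriv_bmo[OF K, of "is @ [i]"] by blast
    show ?thesis
    proof (intro exI[of _ "C1 + C2"] conjI allI impI)
      fix u :: "real ^ 'n \<Rightarrow> real" and b g t r :: real and x assume as: "controlled k \<sigma> p u b x g" "0 < t" "t \<le> (r::real)"
      have "\<bar>dilate_avg (?M i) (weak_deriv u (is @ [i])) x r\<bar> \<le> C2 * (b / r ^ Suc j)"
        using C2(2)[of u "weak_deriv u (is @ [i])" b r x] as Suc.hyps(2) Suc.prems by (auto simp: controlled_def)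
      also have "\<dots> \<le> C2 * (b / r ^ Suc j + r powr (real k + \<sigma> - real (Suc j)) * g)"
        using as by (intro mult_left_mono C2) (auto simp: controlled_def)
      finally show "\<bar>dilate_avg (?M i) (weak_deriv u (is @ [i])) x t\<bar>
          \<le> (C1 + C2) * (b / r ^ Suc j + r powr (real k + \<sigma> - real (Suc j)) * g)"
        using C1(2)[OF as] by (simp add: distrib_right)
    qed (use C1(1) C2(1) in auto)
  qed
  then have "\<forall>i. \<exists>C. C \<ge> 0 \<and> (\<forall>u b x g t r. controlled k \<sigma> p u b x g \<longrightarrow> 0 < t \<longrightarrow> t \<le> r \<longrightarrow>
      \<bar>dilate_avg (?M i) (weak_deriv u (is @ [i])) x t\<bar>
        \<le> C * (b / r ^ Suc j + r powr (real k + \<sigma> - real (Suc j)) * g))"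
    by blast
  from choice[OF this] obtain C where C: "\<And>i. C i \<ge> 0"
    "\<And>i u b x g t r. controlled k \<sigma> p u b x g \<Longrightarrow> 0 < t \<Longrightarrow> t \<le> r \<Longrightarrow>
      \<bar>dilate_avg (?M i) (weak_deriv u (is @ [i])) x t\<bar>
        \<le> C i * (b / r ^ Suc j + r powr (real k + \<sigma> - real (Suc j)) * g)" by blast
  show ?case
  proof (intro exI[of _ "\<Sum>i\<in>UNIV. C i"] conjI allI impI)
    show "(\<Sum>i\<in>UNIV. C i) \<ge> 0" by (intro sum_nonneg C)
    fix u :: "real ^ 'n \<Rightarrow> real" and b g \<rho> r :: real and x assume as: "controlled k \<sigma> p u b x g" "0 < \<rho>" "\<rho> \<le> (r::real)"
    define E where "E = b / r ^ Suc j + r powr (real k + \<sigma> - real (Suc j)) * g"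
    have w: "has_weak_deriv u is (weak_deriv u is)" "has_weak_deriv u (is @ [i]) (weak_deriv u (is @ [i]))" for i
      using as Suc.hyps(2) Suc.prems by (auto simp: controlled_def)
    have "\<bar>dilate_avg L (weak_deriv u is) x \<rho> - dilate_avg L (weak_deriv u is) x r\<bar> \<le> r * (\<Sum>i\<in>UNIV. C i * E)"
      by (rule dilate_avg_mvt[OF w Suc.prems(1) as(2,3)]) (use C(2)[OF as(1)] as(2) in \<open>auto simp: E_def\<close>)
    also have "\<dots> = (\<Sum>i\<in>UNIV. C i) * (r * E)"
      by (simp add: sum_distrib_right[symmetric] mult.left_commute)
    \<comment> \<open>The two terms scale alike: the factor r from the mean value inequality turns
      the order j + 1 into j in both.\<close>
    also have "r * E = b / r ^ j + r powr (real k + \<sigma> - real j) * g"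
    proof -
      have "r * r powr (real k + \<sigma> - real (Suc j)) = r powr (real k + \<sigma> - real j)"
        using as powr_add[of r 1 "real k + \<sigma> - real (Suc j)"] by (simp add: algebra_simps)
      then show ?thesis
        using as by (simp add: E_def distrib_left flip: mult.assoc)
    qed
    finally show "\<bar>dilate_avg L (weak_deriv u is) x \<rho> - dilate_avg L (weak_deriv u is) x r\<bar>
      \<le> (\<Sum>i\<in>UNIV. C i) * (b / r ^ j + r powr (real k + \<sigma> - real j) * g)" .
  qed
qed

text \<open>Below the balancing scale the average is compared with its value there; above that scale
  the bound by mean oscillation suffices, as it decreases in the scale.\<close>

lemma dilate_avg_interpolation:
  fixes L :: "real ^ 'n \<Rightarrow> real"
  assumes p: "p \<ge> 1" and \<sigma>: "\<sigma> > 0" and L: "kernel L" and len: "length is = j" "1 \<le> j" "j \<le> k"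
    and s: "s = real k + \<sigma>"
  shows "\<exists>C\<ge>0. \<forall>u b x g \<rho>. controlled k \<sigma> p u b x g \<longrightarrow> 0 < \<rho> \<longrightarrow>
    \<bar>dilate_avg L (weak_deriv u is) x \<rho>\<bar> \<le> C * (b powr (1 - real j / s) * g powr (real j / s))"
proof -
  obtain C1 where C1: "C1 \<ge> 0" "\<And>u b x g \<rho> r. controlled k \<sigma> p u b x g \<Longrightarrow> 0 < \<rho> \<Longrightarrow> \<rho> \<le> r \<Longrightarrow>
      \<bar>dilate_avg L (weak_deriv u is) x \<rho> - dilate_avg L (weak_deriv u is) x r\<bar>
        \<le> C1 * (b / r ^ j + r powr (s - real j) * g)"
    using dilate_avg_oscillation[OF p \<sigma> L len(1) len(3)] unfolding s by blast
  obtain C2 where C2: "C2 \<ge> 0" "\<And>u g b x r. has_weak_deriv u is g \<Longrightarrow> bmo_oscillation u \<le> ennreal b \<Longrightarrow>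
      b \<ge> 0 \<Longrightarrow> r > 0 \<Longrightarrow> \<bar>dilate_avg L g x r\<bar> \<le> C2 * (b / r ^ j)"
    using dilate_avg_weak_deriv_bmo[OF L, of "is"] len by fastforce
  show ?thesis
  \<comment> \<open>At the balancing scale both terms of the variation equal \<open>E\<close>,
    whence \<open>2 * C1\<close>; \<open>C2\<close> bounds the average at that scale.\<close>
  proof (intro exI[of _ "2 * C1 + C2"] conjI allI impI)
    fix u :: "real ^ 'n \<Rightarrow> real" and b g \<rho> :: real and x assume as: "controlled k \<sigma> p u b x g" "0 < \<rho>"
    then have b: "b > 0" and g: "g > 0" by (simp_all add: controlled_def)
    have s0: "s > 0" using \<sigma> s by simp
    \<comment> \<open>the scale at which the two competing bounds coincide\<close>
    define r where "r = (b / g) powr (1 / s)"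
    have r: "r > 0" using b g by (simp add: r_def)
    define E where "E = b powr (1 - real j / s) * g powr (real j / s)"
    have E: "E \<ge> 0" by (simp add: E_def)
    have "r powr a = (b / g) powr (a / s)" for a
      by (simp add: r_def powr_powr)
    then have *: "r powr a = b powr (a / s) / g powr (a / s)" for a
      using b g by (simp add: powr_divide)
    have e1: "b / r ^ j = E"
      using b g r by (simp add: E_def powr_realpow[symmetric] * powr_diff)
    have e2: "r powr (s - real j) * g = E"
      using b g r s0 by (simp add: E_def * diff_divide_distrib powr_diff)
    have C2': "\<bar>dilate_avg L (weak_deriv u is) x t\<bar> \<le> C2 * (b / t ^ j)" if "t > 0" for t
      using C2(2)[of u "weak_deriv u is" b t x] as that len by (auto simp: controlled_def)
    show "\<bar>dilate_avg L (weak_deriv u is) x \<rho>\<bar> \<le> (2 * C1 + C2) * E"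
    proof (cases "\<rho> \<le> r")
      case True
      have "\<bar>dilate_avg L (weak_deriv u is) x r\<bar> \<le> C2 * E"
        using C2'[OF r] by (simp add: e1)
      moreover have "\<bar>dilate_avg L (weak_deriv u is) x \<rho> - dilate_avg L (weak_deriv u is) x r\<bar> \<le> C1 * (E + E)"
        using C1(2)[OF as True] by (simp only: e1 e2)
      ultimately show ?thesis
        by (simp add: algebra_simps)
    next
      case False
      have "b / \<rho> ^ j \<le> b / r ^ j"
        using False b r by (intro divide_left_mono power_mono) auto
      then have "C2 * (b / \<rho> ^ j) \<le> C2 * E"
        using C2(1) unfolding e1 by (rule mult_left_mono)
      moreover have "C1 * E \<ge> 0" using C1 E by simp
      ultimately show ?thesis
        using C2'[OF as(2)] by (simp add: algebra_simps)
    qed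
  qed (use C1 C2 in auto)
qed

text \<open>Oscillation says nothing about the size of \<open>u\<close>, so that size is supplied at
  scale 1 by \<open>A\<close>. From there an intermediate scale is reached with the BMO bound on
  averages of the gradient, and smaller scales with the variation bound involving the
  energy.\<close>

lemma dilate_avg_order_zero:
  fixes L :: "real ^ 'n \<Rightarrow> real"
  assumes p: "p \<ge> 1" and \<sigma>: "\<sigma> > 0" and L: "kernel L" and k: "1 \<le> k"
    and s: "s = real k + \<sigma>"
  shows "\<exists>C\<ge>0. \<forall>u b x g \<rho> A. controlled k \<sigma> p u b x g \<longrightarrow> 0 < \<rho> \<longrightarrow> \<rho> \<le> 1 \<longrightarrow>
    \<bar>dilate_avg L (weak_deriv u []) x 1\<bar> \<le> A \<longrightarrow>
    \<bar>dilate_avg L (weak_deriv u []) x \<rho>\<bar> \<le> A + C * (1 + b) * (1 + g powr (1 / s))"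
proof -
  let ?M = "\<lambda>i z. z $ i * L z"
  obtain C1 where C1: "C1 \<ge> 0" "\<And>u b x g \<rho> r. controlled k \<sigma> p u b x g \<Longrightarrow> 0 < \<rho> \<Longrightarrow> \<rho> \<le> r \<Longrightarrow>
      \<bar>dilate_avg L (weak_deriv u []) x \<rho> - dilate_avg L (weak_deriv u []) x r\<bar>
        \<le> C1 * (b + r powr s * g)"
    using dilate_avg_oscillation[OF p \<sigma> L, of "[]" 0 k] unfolding s by auto
  have "\<exists>C\<ge>0. \<forall>u g b x r. has_weak_deriv u [i] g \<longrightarrow> bmo_oscillation u \<le> ennreal b \<longrightarrow>
      b \<ge> 0 \<longrightarrow> r > 0 \<longrightarrow> \<bar>dilate_avg (?M i) g x r\<bar> \<le> C * (b / r)" for i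
    using dilate_avg_weak_deriv_bmo[OF kernel_mult_coord[OF L], of "[i]"] by simp
  then have "\<forall>i. \<exists>C. C\<ge>0 \<and> (\<forall>u g b x r. has_weak_deriv u [i] g \<longrightarrow> bmo_oscillation u \<le> ennreal b \<longrightarrow>
      b \<ge> 0 \<longrightarrow> r > 0 \<longrightarrow> \<bar>dilate_avg (?M i) g x r\<bar> \<le> C * (b / r))"
    by blast
  from choice[OF this] obtain c where c: "\<And>i. c i \<ge> 0"
    "\<And>i u g b x r. has_weak_deriv u [i] g \<Longrightarrow> bmo_oscillation u \<le> ennreal b \<Longrightarrow>
      b \<ge> 0 \<Longrightarrow> r > 0 \<Longrightarrow> \<bar>dilate_avg (?M i) g x r\<bar> \<le> c i * (b / r)" by blast
  define C2 where "C2 = sum c UNIV"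
  have C2: "C2 \<ge> 0" unfolding C2_def by (intro sum_nonneg c)
  show ?thesis
  proof (intro exI[of _ "C1 + C2"] conjI allI impI)
    fix u :: "real ^ 'n \<Rightarrow> real" and b g \<rho> A :: real and x
    assume as: "controlled k \<sigma> p u b x g" "0 < \<rho>" "\<rho> \<le> 1"
      and A: "\<bar>dilate_avg L (weak_deriv u []) x 1\<bar> \<le> A"
    then have b: "b > 0" and g: "g > 0" by (simp_all add: controlled_def)
    have s0: "s > 0" using \<sigma> s by simp
    let ?F = "dilate_avg L (weak_deriv u []) x"
    have w: "has_weak_deriv u [] (weak_deriv u [])" "has_weak_deriv u ([] @ [i]) (weak_deriv u ([] @ [i]))" for i
      using as k by (auto simp: controlled_def)
    \<comment> \<open>The gradient averages at scales in [t, 1] are at most a multiple of b/t.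
      Integrating over the scales would give a logarithm; the cruder 1/t becomes
      \<open>g powr (1 / s)\<close>, which is still admissible since 1 <= l.\<close>
    have far: "\<bar>?F t - ?F 1\<bar> \<le> C2 * (b / t)" if t: "0 < t" "t \<le> 1" for t
    proof -
      have "\<bar>?F t - ?F 1\<bar> \<le> 1 * (\<Sum>i\<in>UNIV. c i * (b / t))"
      proof (rule dilate_avg_mvt[OF w L t])
        fix i t' assume t': "t' \<in> {t..1}"
        have "\<bar>dilate_avg (?M i) (weak_deriv u ([] @ [i])) x t'\<bar> \<le> c i * (b / t')"
          using c(2)[of u i "weak_deriv u [i]" b t' x] w(2)[of i] as t t' by (auto simp: controlled_def)
        also have "\<dots> \<le> c i * (b / t)"
          using t t' b by (intro mult_left_mono divide_left_mono c) auto
        finally show "\<bar>dilate_avg (?M i) (weak_deriv u ([] @ [i])) x t'\<bar> \<le> c i * (b / t)" .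
      qed
      then show ?thesis
        unfolding C2_def sum_distrib_right[symmetric] by simp
    qed
    \<comment> \<open>the scale at which \<open>r powr s * g\<close> is at most \<open>1\<close>, while \<open>1 / r\<close> is still controlled by \<open>g powr (1 / s)\<close>\<close>
    define r where "r = min 1 (g powr (- 1 / s))"
    have r: "0 < r" "r \<le> 1" using g by (auto simp: r_def)
    have rs: "r powr s * g \<le> 1"
    proof -
      have "r powr s \<le> (g powr (- 1 / s)) powr s"
        using r s0 by (intro powr_mono2) (auto simp: r_def)
      also have "\<dots> = 1 / g"
        using g s0 by (simp add: powr_powr powr_minus_divide[of g 1])
      finally show ?thesis
        using g by (simp add: field_simps)
    qed
    define h where "h = g powr (1 / s)"
    have h: "h \<ge> 0" by (simp add: h_def)
    have r1: "1 / r \<le> 1 + h"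
    proof -
      have "1 / r = max 1 h"
        using g by (auto simp: r_def h_def powr_minus_divide min_def max_def field_simps)
      then show ?thesis using h by simp
    qed
    have br: "b / r \<le> (1 + b) * (1 + h)"
      using mult_mono[of b "1 + b" "1 / r" "1 + h"] b r1 r h by simp
    have near: "\<bar>?F r\<bar> \<le> A + C2 * ((1 + b) * (1 + h))"
      using far[OF r] A mult_left_mono[OF br C2] by linarith
    show "\<bar>?F \<rho>\<bar> \<le> A + (C1 + C2) * (1 + b) * (1 + h)"
    proof (cases "\<rho> \<le> r")
      case True
      have "b + r powr s * g \<le> (1 + b) * (1 + h)"
      proof -
        have "(1 + b) * (1 + h) = 1 + b + h + b * h" by (simp add: algebra_simps)
        then show ?thesis
          using rs h b mult_nonneg_nonneg[of b h] by linarith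
      qed
      then have "C1 * (b + r powr s * g) \<le> C1 * ((1 + b) * (1 + h))"
        using C1(1) by (rule mult_left_mono)
      then have "\<bar>?F \<rho>\<bar> \<le> A + C1 * ((1 + b) * (1 + h)) + C2 * ((1 + b) * (1 + h))"
        using C1(2)[OF as(1,2) True] near by linarith
      then show ?thesis
        by (simp add: algebra_simps)
    next
      case False
      have "b / \<rho> \<le> b / r"
        using False b r by (intro divide_left_mono) auto
      then have "C2 * (b / \<rho>) \<le> C2 * ((1 + b) * (1 + h))"
        using C2 br by (intro mult_left_mono) auto
      moreover have "C1 * ((1 + b) * (1 + h)) \<ge> 0"
        using C1(1) b h by simp
      ultimately have "\<bar>?F \<rho>\<bar> \<le> A + C1 * ((1 + b) * (1 + h)) + C2 * ((1 + b) * (1 + h))"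
        using far[OF as(2,3)] A by linarith
      then show ?thesis
        by (simp add: algebra_simps)
    qed
  qed (use C1 C2 in auto)
qed

subsection \<open>Testing against smooth functions\<close>

definition box_bump :: "real ^ 'n \<Rightarrow> real ^ 'n \<Rightarrow> real ^ 'n \<Rightarrow> real" where
  "box_bump a b x = (\<Prod>i\<in>UNIV. flat 0 (x $ i - a $ i) * flat 0 (b $ i - x $ i))"

lemma flat_nonneg: "flat m t \<ge> 0" and flat_0_pos_iff: "flat 0 t > 0 \<longleftrightarrow> t > 0"
  by (auto simp: flat_def)

lemma box_bump_elementary: "box_bump a b \<in> elementary"
  unfolding box_bump_def[abs_def]
  by (intro elementary_prod elementary.intros elementary_diff)

lemma box_bump_nonneg: "box_bump a b x \<ge> 0"
  unfolding box_bump_def by (intro prod_nonneg mult_nonneg_nonneg flat_nonneg)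

lemma box_bump_pos: "x \<in> box a b \<Longrightarrow> box_bump a b x > 0"
  unfolding box_bump_def by (intro prod_pos) (auto simp: mem_box_cart flat_0_pos_iff)

lemma box_bump_zero:
  assumes "x \<notin> box a b"
  shows "box_bump a b x = 0"
proof -
  obtain i where "\<not> (a $ i < x $ i \<and> x $ i < b $ i)"
    using assms by (auto simp: mem_box_cart)
  then show ?thesis
    unfolding box_bump_def by (intro prod_zero) (auto simp: flat_def)
qed

text \<open>An open set is a countable union of open boxes, each carrying a bump that is positive on
  it. Partial sums of the bumps become positive at every point of \<open>U\<close>, and 1 - exp(- n
  times the sum) drives the values to 1 without leaving the elementary functions.\<close>

lemma elementary_approximation_open:
  fixes U :: "(real ^ 'n) set"
  assumes U: "open U" "bounded U"
  obtains \<psi> :: "nat \<Rightarrow> real ^ 'n \<Rightarrow> real" where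
    "\<And>n. \<psi> n \<in> elementary" "\<And>n. test_function (\<psi> n)" "\<And>n x. 0 \<le> \<psi> n x" "\<And>n x. \<psi> n x \<le> 1"
    "\<And>n x. x \<notin> U \<Longrightarrow> \<psi> n x = 0" "\<And>x. x \<in> U \<Longrightarrow> (\<lambda>n. \<psi> n x) \<longlonglongrightarrow> 1"
proof -
  obtain D where D: "countable D" "D \<subseteq> Pow U" "\<And>X. X \<in> D \<Longrightarrow> \<exists>a b. X = box a b" "\<Union>D = U"
    using open_countable_Union_open_box[OF U(1)] by metis
  \<comment> \<open>The empty box makes the family nonempty, so that it can be enumerated even when
    \<open>U\<close> is empty.\<close>
  define D' where "D' = insert {} D"
  have D': "countable D'" "D' \<noteq> {}" "\<Union>D' = U"
    using D by (auto simp: D'_def)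
  have box: "\<exists>a b. X = box a b" if "X \<in> D'" for X
  proof (cases "X = {}")
    case True
    then have "X = box 0 0" by (auto simp: mem_box_cart)
    then show ?thesis by blast
  qed (use that D(3) in \<open>auto simp: D'_def\<close>)
  then have "\<forall>m. \<exists>a b. from_nat_into D' m = box a b"
    using from_nat_into[OF D'(2)] by blast
  then obtain a b where ab: "\<And>m. from_nat_into D' m = box (a m) (b m)"
    by metis
  have sub: "box (a m) (b m) \<subseteq> U" for m
    using from_nat_into[OF D'(2), of m] D'(3) ab by auto
  define \<eta> where "\<eta> n x = (\<Sum>m<n. box_bump (a m) (b m) x)" for n x
  define \<psi> where "\<psi> n x = 1 - exp (- real n * \<eta> n x)" for n x
  have \<eta>: "\<eta> n x \<ge> 0" for n x
    unfolding \<eta>_def by (intro sum_nonneg box_bump_nonneg)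
  show ?thesis
  proof (rule that[of \<psi>])
    show el: "\<psi> n \<in> elementary" for n
      unfolding \<psi>_def[abs_def] \<eta>_def
      by (intro elementary_diff elementary.intros elementary_sum box_bump_elementary)
    show zero: "\<psi> n x = 0" if "x \<notin> U" for n x
      using that sub by (auto simp: \<psi>_def \<eta>_def intro!: sum.neutral box_bump_zero)
    show "test_function (\<psi> n)" for n
      by (rule test_functionI[OF el bounded_subset[OF U(2)]]) (use zero in blast)
    show "0 \<le> \<psi> n x" "\<psi> n x \<le> 1" for n x
      using \<eta>[of n x] by (auto simp: \<psi>_def)
    show "(\<lambda>n. \<psi> n x) \<longlonglongrightarrow> 1" if xU: "x \<in> U" for x
    proof -
      obtain X where "X \<in> D'" "x \<in> X"
        using xU D'(3) by blast
      then obtain m where m: "x \<in> box (a m) (b m)"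
        using from_nat_into_surj[OF D'(1)] ab by metis
      define \<delta> where "\<delta> = box_bump (a m) (b m) x"
      have \<delta>: "\<delta> > 0"
        using box_bump_pos[OF m] by (simp add: \<delta>_def)
      have "(\<lambda>n. 1 - exp (- real n * \<delta>)) \<longlonglongrightarrow> 1 - 0"
      proof (intro tendsto_diff tendsto_const filterlim_compose[OF exp_at_bot])
        show "filterlim (\<lambda>n. - real n * \<delta>) at_bot sequentially"
          using filterlim_tendsto_pos_mult_at_top[OF tendsto_const \<delta> filterlim_real_sequentially]
          by (simp add: filterlim_uminus_at_bot mult.commute)
      qed
      then have lim: "(\<lambda>n. 1 - exp (- real n * \<delta>)) \<longlonglongrightarrow> 1" by simp
      show ?thesis
      proof (rule tendsto_sandwich[OF _ _ lim tendsto_const])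
        show "\<forall>\<^sub>F n in sequentially. 1 - exp (- real n * \<delta>) \<le> \<psi> n x"
          using eventually_gt_at_top[of m]
        proof eventually_elim
          case (elim n)
          have "\<delta> \<le> \<eta> n x"
            unfolding \<eta>_def \<delta>_def using elim
            by (intro member_le_sum box_bump_nonneg) auto
          then show ?case
            by (simp add: \<psi>_def mult_left_mono)
        qed
        show "\<forall>\<^sub>F n in sequentially. \<psi> n x \<le> 1"
          by (simp add: \<psi>_def)
      qed
    qed
  qed
qed

section \<open>From integrals against test functions to inequalities almost everywhere\<close>

lemma locally_integrable_indicator_bounded:
  fixes w :: "real ^ 'n \<Rightarrow> real"
  assumes w: "locally_integrable w" and A: "A \<in> sets lebesgue" "bounded A"
  shows "integrable lebesgue (\<lambda>x. w x * indicator A x)"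
  using A closure_subset
  by (intro integrable_mult_compact_support[OF w, where K="closure A" and C=1])
     (auto simp: compact_closure indicator_def)

lemma integral_open_nonneg:
  fixes w :: "real ^ 'n \<Rightarrow> real"
  assumes w: "locally_integrable w"
    and nn: "\<And>\<psi>. \<psi> \<in> elementary \<Longrightarrow> test_function \<psi> \<Longrightarrow> (\<And>x. 0 \<le> \<psi> x) \<Longrightarrow> 0 \<le> (LINT x|lebesgue. w x * \<psi> x)"
    and U: "open U" "bounded U"
  shows "0 \<le> (LINT x|lebesgue. w x * indicator U x)"
proof -
  obtain \<psi> where \<psi>: "\<And>n. \<psi> n \<in> elementary" "\<And>n. test_function (\<psi> n)" "\<And>n x. 0 \<le> \<psi> n x" "\<And>n x. \<psi> n x \<le> 1"
    "\<And>n x. x \<notin> U \<Longrightarrow> \<psi> n x = 0" "\<And>x. x \<in> U \<Longrightarrow> (\<lambda>n. \<psi> n x) \<longlonglongrightarrow> 1"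
    using elementary_approximation_open[OF U] by blast
  have wm[measurable]: "w \<in> borel_measurable lebesgue"
    by (rule locally_integrable_measurable[OF w])
  have Um: "U \<in> sets lebesgue" using U by auto
  have \<psi>m: "\<psi> n \<in> borel_measurable lebesgue" for n
    using elementary_measurable[OF \<psi>(1)] by (intro measurable_completion) simp
  have "(\<lambda>n. LINT x|lebesgue. w x * \<psi> n x) \<longlonglongrightarrow> (LINT x|lebesgue. w x * indicator U x)"
  proof (rule integral_dominated_convergence[where w="\<lambda>x. \<bar>w x * indicator U x\<bar>"])
    show "integrable lebesgue (\<lambda>x. \<bar>w x * indicator U x\<bar>)"
      using locally_integrable_indicator_bounded[OF w Um U(2)] by auto
    show "AE x in lebesgue. (\<lambda>n. w x * \<psi> n x) \<longlonglongrightarrow> w x * indicator U x"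
    proof (rule AE_I2)
      fix x show "(\<lambda>n. w x * \<psi> n x) \<longlonglongrightarrow> w x * indicator U x"
        using \<psi>(5,6)[of x] by (cases "x \<in> U") (auto intro!: tendsto_eq_intros)
    qed
    show "AE x in lebesgue. norm (w x * \<psi> n x) \<le> \<bar>w x * indicator U x\<bar>" for n
    proof (rule AE_I2)
      fix x show "norm (w x * \<psi> n x) \<le> \<bar>w x * indicator U x\<bar>"
        using \<psi>(3)[of n x] \<psi>(4)[of n x] \<psi>(5)[of x n] mult_left_mono[of "\<psi> n x" 1 "\<bar>w x\<bar>"]
        by (cases "x \<in> U") (auto simp: abs_mult \<psi>(3,5) abs_of_nonneg)
    qed
  qed (use wm \<psi>m Um in auto)
  then show ?thesis
    by (rule LIMSEQ_le_const) (use nn \<psi> in blast)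
qed

text \<open>By outer regularity the negative set of \<open>w\<close> in a ball is, up to a null set,
  a decreasing intersection of bounded open sets over each of which \<open>w\<close> has nonnegative
  integral. In the limit the integral over the negative set is nonnegative too, so that set is
  null.\<close>

lemma AE_nonneg_of_test_functions:
  fixes w :: "real ^ 'n \<Rightarrow> real"
  assumes w: "locally_integrable w"
    and nn: "\<And>\<psi>. \<psi> \<in> elementary \<Longrightarrow> test_function \<psi> \<Longrightarrow> (\<And>x. 0 \<le> \<psi> x) \<Longrightarrow> 0 \<le> (LINT x|lebesgue. w x * \<psi> x)"
  shows "AE x in lebesgue. 0 \<le> w x"
proof -
  have wm[measurable]: "w \<in> borel_measurable lebesgue"
    by (rule locally_integrable_measurable[OF w])
  have "AE x in lebesgue. x \<in> ball 0 (real R) \<longrightarrow> 0 \<le> w x" for R :: nat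
  proof -
    define A where "A = {x \<in> ball 0 (real R). w x < 0}"
    have A: "A \<in> sets lebesgue" "bounded A"
    proof -
      have "{x \<in> space lebesgue. w x < 0} \<in> sets lebesgue" by measurable
      moreover have "A = {x \<in> space lebesgue. w x < 0} \<inter> ball 0 (real R)"
        by (auto simp: A_def)
      ultimately show "A \<in> sets lebesgue" by auto
      show "bounded A" by (rule bounded_subset[OF bounded_ball[of 0 "real R"]]) (auto simp: A_def)
    qed
    have "\<forall>n::nat. \<exists>T. open T \<and> A \<subseteq> T \<and> T - A \<in> lmeasurable \<and> emeasure lebesgue (T - A) < ennreal (1 / (n + 1))"
      using sets_lebesgue_outer_open[OF A(1)] by (metis of_nat_0_less_iff of_nat_1 of_nat_add zero_less_divide_1_iff zero_less_Suc Suc_eq_plus1)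
    then obtain T where T: "\<And>n. open (T n)" "\<And>n. A \<subseteq> T n" "\<And>n. T n - A \<in> lmeasurable"
      "\<And>n. emeasure lebesgue (T n - A) < ennreal (1 / (real n + 1))"
      by metis
    \<comment> \<open>Finite intersections stay open and become decreasing; the ball provides a
      common integrable majorant.\<close>
    define V where "V n = (\<Inter>m\<le>n. T m) \<inter> ball 0 (real R)" for n
    have V: "open (V n)" "bounded (V n)" "A \<subseteq> V n" for n
      using T(1,2) by (auto simp: V_def A_def intro!: open_INT)
    define W where "W = (\<Inter>n. V n)"
    have Wm: "W \<in> sets lebesgue"
      unfolding W_def using V(1) by (intro sets.countable_INT) auto
    have null: "W - A \<in> null_sets lebesgue"
    proof (rule null_setsI)
      show "W - A \<in> sets lebesgue" using Wm A by auto
      have "emeasure lebesgue (W - A) \<le> ennreal (1 / (real n + 1))" for n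
      proof -
        have "W - A \<subseteq> T n - A" by (auto simp: W_def V_def)
        then have "emeasure lebesgue (W - A) \<le> emeasure lebesgue (T n - A)"
          using T(3) by (intro emeasure_mono) auto
        then show ?thesis using T(4)[of n] by simp
      qed
      moreover have "(\<lambda>n. ennreal (1 / (real n + 1))) \<longlonglongrightarrow> ennreal 0"
        using LIMSEQ_inverse_real_of_nat by (intro tendsto_ennrealI) (simp add: inverse_eq_divide add.commute)
      ultimately have "emeasure lebesgue (W - A) \<le> ennreal 0"
        by (intro LIMSEQ_le_const) auto
      then show "emeasure lebesgue (W - A) = 0" by simp
    qed
    have "(\<lambda>n. LINT x|lebesgue. w x * indicator (V n) x) \<longlonglongrightarrow> (LINT x|lebesgue. w x * indicator W x)"
    proof (rule integral_dominated_convergence[where w="\<lambda>x. \<bar>w x * indicator (ball 0 (real R)) x\<bar>"])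
      show "integrable lebesgue (\<lambda>x. \<bar>w x * indicator (ball 0 (real R)) x\<bar>)"
        using locally_integrable_indicator_bounded[OF w, of "ball 0 (real R)"] by auto
      show "AE x in lebesgue. (\<lambda>n. w x * indicator (V n) x) \<longlonglongrightarrow> w x * indicator W x"
      proof (rule AE_I2)
        fix x
        have "(\<lambda>n. indicator (V n) x :: real) \<longlonglongrightarrow> indicator (\<Inter>n. V n) x"
          by (rule LIMSEQ_indicator_decseq) (fastforce simp: V_def decseq_def)
        then show "(\<lambda>n. w x * indicator (V n) x) \<longlonglongrightarrow> w x * indicator W x"
          unfolding W_def by (rule tendsto_mult_left)
      qed
      show "AE x in lebesgue. norm (w x * indicator (V n) x) \<le> \<bar>w x * indicator (ball 0 (real R)) x\<bar>" for n
        by (rule AE_I2) (auto simp: V_def indicator_def)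
      show "(\<lambda>x. w x * indicator (V n) x) \<in> borel_measurable lebesgue" for n
        using V(1)[of n] by (intro borel_measurable_times wm borel_measurable_indicator) auto
    qed (use Wm in auto)
    then have "0 \<le> (LINT x|lebesgue. w x * indicator W x)"
      by (rule LIMSEQ_le_const) (use integral_open_nonneg[OF w nn V(1,2)] in blast)
    also have "\<dots> = (LINT x|lebesgue. w x * indicator A x)"
    proof (rule integral_cong_AE)
      show "AE x in lebesgue. w x * indicator W x = w x * indicator A x"
        using AE_not_in[OF null] by eventually_elim (use V(3) in \<open>auto simp: W_def indicator_def\<close>)
    qed (use Wm A in auto)
    finally have "(LINT x|lebesgue. - (w x * indicator A x)) \<le> 0"
      by simp
    moreover have nonneg: "0 \<le> - (w x * indicator A x)" for x
      by (auto simp: A_def indicator_def)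
    ultimately have "(LINT x|lebesgue. - (w x * indicator A x)) = 0"
      by (intro antisym Bochner_Integration.integral_nonneg) auto
    then have "AE x in lebesgue. - (w x * indicator A x) = 0"
      using locally_integrable_indicator_bounded[OF w A] nonneg
      by (subst (asm) integral_nonneg_eq_0_iff_AE) auto
    then show ?thesis
      by eventually_elim (auto simp: A_def indicator_def split: if_splits)
  qed
  then have "AE x in lebesgue. \<forall>R::nat. x \<in> ball 0 (real R) \<longrightarrow> 0 \<le> w x"
    by (subst AE_all_countable) blast
  then show ?thesis
  proof eventually_elim
    case (elim x)
    obtain R :: nat where "norm x < real R"
      using reals_Archimedean2 by blast
    then show ?case using elim by auto
  qed
qed

lemma locally_integrable_add:
  "locally_integrable f \<Longrightarrow> locally_integrable g \<Longrightarrow> locally_integrable (\<lambda>x. f x + g x)"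
  by (auto simp: locally_integrable_def intro: set_integral_add)

lemma locally_integrable_cmult:
  "locally_integrable f \<Longrightarrow> locally_integrable (\<lambda>x. c * f x)"
  by (auto simp: locally_integrable_def)

lemma AE_eq_of_test_functions:
  fixes f g :: "real ^ 'n \<Rightarrow> real"
  assumes f: "locally_integrable f" and g: "locally_integrable g"
    and eq: "\<And>\<psi>. test_function \<psi> \<Longrightarrow> (LINT x|lebesgue. f x * \<psi> x) = (LINT x|lebesgue. g x * \<psi> x)"
  shows "AE x in lebesgue. f x = g x"
proof -
  have *: "AE x in lebesgue. 0 \<le> c * f x + (- c) * g x" for c
  proof (rule AE_nonneg_of_test_functions)
    show "locally_integrable (\<lambda>x. c * f x + (- c) * g x)"
      by (intro locally_integrable_add locally_integrable_cmult f g)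
    fix \<psi> :: "real ^ 'n \<Rightarrow> real" assume el: "\<psi> \<in> elementary" and \<psi>: "test_function \<psi>"
    have \<psi>m: "\<psi> \<in> borel_measurable lebesgue"
      using elementary_measurable[OF el] by (intro measurable_completion) simp
    have K: "compact (closure {x. \<psi> x \<noteq> 0})"
      using \<psi> by (simp add: test_function_def)
    have zero: "\<psi> y = 0" if "y \<notin> closure {x. \<psi> x \<noteq> 0}" for y
      using that closure_subset[of "{x. \<psi> x \<noteq> 0}"] by auto
    have "compact (\<psi> ` closure {x. \<psi> x \<noteq> 0})"
      by (intro compact_continuous_image elementary_continuous el K)
    then obtain C0 where C0: "\<forall>t\<in>\<psi> ` closure {x. \<psi> x \<noteq> 0}. norm t \<le> C0"
      using compact_imp_bounded bounded_iff by metis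
    have C: "\<bar>\<psi> y\<bar> \<le> max C0 0" for y
      using C0 zero[of y] by (cases "y \<in> closure {x. \<psi> x \<noteq> 0}") (auto simp: le_max_iff_disj)
    have "integrable lebesgue (\<lambda>y. h y * \<psi> y)" if "locally_integrable h" for h
      by (rule integrable_mult_compact_support[OF that K \<psi>m C zero])
    then show "0 \<le> (LINT x|lebesgue. (c * f x + (- c) * g x) * \<psi> x)"
      using f g eq[OF \<psi>] by (simp add: distrib_right left_diff_distrib mult.assoc)
  qed
  show ?thesis
    using *[of 1] *[of "-1"] by eventually_elim auto
qed

text \<open>Transfers what is known of one convenient weak derivative to the representative selected
  by \<open>weak_deriv\<close>.\<close>

lemma has_weak_deriv_unique:
  "has_weak_deriv u is g \<Longrightarrow> has_weak_deriv u is h \<Longrightarrow> AE x in lebesgue. g x = h x"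
  by (rule AE_eq_of_test_functions) (auto simp: has_weak_deriv_def)

text \<open>The squared norm is a polynomial in the coordinates, which keeps the bump elementary.
  Evenness is what later lets an average be moved from one factor of an integral to the
  other.\<close>

definition unit_bump :: "real ^ 'n \<Rightarrow> real" where
  "unit_bump y = flat 0 (1 - (\<Sum>i\<in>UNIV. y $ i * y $ i))"

lemma sum_squares_eq_norm: "(\<Sum>i\<in>UNIV. y $ i * y $ i) = (norm (y :: real ^ 'n))\<^sup>2"
  by (simp add: norm_vec_def L2_set_def sum_nonneg flip: power2_eq_square)

lemma unit_bump_kernel: "kernel (unit_bump :: real ^ 'n \<Rightarrow> real)"
proof -
  have "(unit_bump :: real ^ 'n \<Rightarrow> real) \<in> elementary"
    unfolding unit_bump_def[abs_def]
    by (intro elementary.flat elementary_diff elementary_sum elementary.const elementary.mult elementary.coord)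
  moreover have "unit_bump x = 0" if "norm x > 1" for x :: "real ^ 'n"
  proof -
    have "(norm x)\<^sup>2 > 1"
      using that by (intro one_less_power) auto
    then have "\<not> 1 - (\<Sum>i\<in>UNIV. x $ i * x $ i) > 0"
      unfolding sum_squares_eq_norm by linarith
    then show ?thesis
      by (simp only: unit_bump_def flat_def if_False)
  qed
  ultimately show ?thesis
    by (simp add: kernel_def)
qed

lemma unit_bump_even: "unit_bump (- y) = unit_bump y"
  by (simp add: unit_bump_def)

lemma integrable_kernel_self:
  fixes L :: "real ^ 'n \<Rightarrow> real"
  shows "kernel L \<Longrightarrow> integrable lebesgue L"
  using integrable_kernel[OF locally_integrable_const[of 1], of L 1 0] by simp

text \<open>The pointwise bounds are divided by this integral. Were it 0, the nonnegative bump would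
  vanish almost everywhere and the unit ball would be null.\<close>

lemma integral_unit_bump_pos: "(LINT y|lebesgue. (unit_bump y :: real)) > 0"
proof (rule ccontr)
  assume "\<not> (LINT y|lebesgue. (unit_bump (y :: real ^ 'n) :: real)) > 0"
  then have "(LINT y|lebesgue. (unit_bump (y :: real ^ 'n) :: real)) = 0"
    by (intro antisym Bochner_Integration.integral_nonneg) (auto simp: unit_bump_def flat_nonneg)
  then have "AE y in lebesgue. (unit_bump (y :: real ^ 'n) :: real) = 0"
    using integrable_kernel_self[OF unit_bump_kernel]
    by (subst (asm) integral_nonneg_eq_0_iff_AE) (auto simp: unit_bump_def flat_nonneg)
  then have "AE y in lebesgue. (y :: real ^ 'n) \<notin> ball 0 1"
  proof eventually_elim
    case (elim y)
    show ?case
    proof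
      assume "y \<in> ball 0 1"
      then have "(norm y)\<^sup>2 < 1" by (simp add: power_less_one_iff abs_square_less_1)
      then have "unit_bump y > 0" by (simp add: unit_bump_def sum_squares_eq_norm flat_0_pos_iff)
      then show False using elim by simp
    qed
  qed
  then have "ball 0 1 \<in> null_sets (lebesgue :: (real ^ 'n) measure)"
    by (subst AE_iff_null_sets) auto
  then have "emeasure lebesgue (ball (0 :: real ^ 'n) 1) = 0"
    by (rule null_setsD1)
  then show False
    using unit_ball_vol_pos[of "real CARD('n)"] by (simp add: emeasure_ball)
qed

text \<open>On a product with \<open>lebesgue\<close> as a factor, the coordinates are used as
  Borel-valued maps, so that Borel functions of them are measurable for the product.\<close>

lemma measurable_id_lebesgue: "(\<lambda>x. x) \<in> lebesgue \<rightarrow>\<^sub>M borel"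
  by (rule measurable_completion) simp

lemma measurable_fst_lebesgue: "fst \<in> lebesgue \<Otimes>\<^sub>M M \<rightarrow>\<^sub>M borel"
  by (rule measurable_compose[OF measurable_fst measurable_id_lebesgue])

lemma measurable_snd_lebesgue: "snd \<in> M \<Otimes>\<^sub>M lebesgue \<rightarrow>\<^sub>M borel"
  by (rule measurable_compose[OF measurable_snd measurable_id_lebesgue])

section \<open>Weak convergence of the averages at vanishing scale\<close>

context
  fixes \<phi> \<psi> v :: "real ^ 'n \<Rightarrow> real" and R :: real
  assumes \<phi>: "kernel \<phi>" "\<And>y. \<phi> (- y) = \<phi> y"
    and \<psi>: "\<psi> \<in> elementary" "\<And>x. x \<notin> cball 0 R \<Longrightarrow> \<psi> x = 0"
    and v: "locally_integrable v"
begin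

lemma elementary_compact_support_bounded: "\<exists>M\<ge>0. \<forall>x. \<bar>\<psi> x\<bar> \<le> M"
proof -
  have "compact (\<psi> ` cball 0 R)"
    by (intro compact_continuous_image elementary_continuous \<psi>) auto
  then obtain C where C: "\<forall>t\<in>\<psi> ` cball 0 R. norm t \<le> C"
    using compact_imp_bounded bounded_iff by metis
  have "\<bar>\<psi> y\<bar> \<le> max C 0" for y
    using C \<psi>(2)[of y] by (cases "y \<in> cball 0 R") (auto simp: le_max_iff_disj)
  then show ?thesis
    by (intro exI[of _ "max C 0"]) auto
qed

text \<open>The averaging is moved from \<open>v\<close>, which is only locally integrable, to the
  continuous function \<open>\<psi>\<close>. The support of \<open>\<psi>\<close> and the bound on
  the scale confine both variables to bounded sets, which yields the majorant for Fubini.\<close>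

lemma fubini_dilate_avg:
  assumes \<rho>: "0 < \<rho>" "\<rho> \<le> 1"
  shows "integrable lebesgue (\<lambda>x. dilate_avg \<phi> v x \<rho> * \<psi> x)"
    and "(LINT x|lebesgue. dilate_avg \<phi> v x \<rho> * \<psi> x) =
      (LINT y|lebesgue. v y * (LINT z|lebesgue. \<phi> z * \<psi> (y + \<rho> *\<^sub>R z)))"
proof -
  interpret lb: sigma_finite_measure "lebesgue :: (real ^ 'n) measure"
    by (rule sigma_finite_lebesgue)
  interpret lb2: pair_sigma_finite "lebesgue :: (real ^ 'n) measure" "lebesgue :: (real ^ 'n) measure" ..
  obtain M where M: "M \<ge> 0" "\<And>x. \<bar>\<psi> x\<bar> \<le> M"
    using elementary_compact_support_bounded by blast
  obtain m where m: "m \<ge> 0" "\<And>x. \<bar>\<phi> x\<bar> \<le> m"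
    using kernel_bounded[OF \<phi>(1)] by blast
  \<comment> \<open>Every point within distance \<rho> <= 1 of the support ball of
    \<open>\<psi>\<close> lies in \<open>K\<close>.\<close>
  define K where "K = cball (0 :: real ^ 'n) (R + 1)"
  have v': "integrable lebesgue (\<lambda>y. v y * indicator K y)"
    by (rule locally_integrable_indicator_bounded[OF v]) (auto simp: K_def)
  have \<phi>K: "\<phi> ((y - x) /\<^sub>R \<rho>) = 0" if "x \<in> cball 0 R" "y \<notin> K" for x y
  proof (rule kernel_rescale_zero[OF \<phi>(1) \<rho>(1)])
    show "y \<notin> cball x \<rho>"
      using that \<rho> norm_triangle_ineq2[of y x] by (auto simp: K_def dist_norm norm_minus_commute)
  qed
  define f where "f x y = v y * \<phi> ((y - x) /\<^sub>R \<rho>) * \<psi> x" for x y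
  have vm: "(\<lambda>q. v (snd q)) \<in> borel_measurable (lebesgue \<Otimes>\<^sub>M lebesgue)"
    by (rule measurable_compose[OF measurable_snd locally_integrable_measurable[OF v]])
  have "(\<lambda>q. (snd q - fst q) /\<^sub>R \<rho>) \<in> borel_measurable (lebesgue \<Otimes>\<^sub>M lebesgue)"
    using measurable_fst_lebesgue measurable_snd_lebesgue by (intro borel_measurable_scaleR borel_measurable_diff) auto
  from measurable_compose[OF this kernel_measurable(2)[OF \<phi>(1)]]
  have \<phi>m: "(\<lambda>q. \<phi> ((snd q - fst q) /\<^sub>R \<rho>)) \<in> borel_measurable (lebesgue \<Otimes>\<^sub>M lebesgue)" .
  have \<psi>m: "(\<lambda>q. \<psi> (fst q)) \<in> borel_measurable (lebesgue \<Otimes>\<^sub>M lebesgue)"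
    by (rule measurable_compose[OF measurable_fst_lebesgue elementary_measurable[OF \<psi>(1)]])
  have fm: "case_prod f \<in> borel_measurable (lebesgue \<Otimes>\<^sub>M lebesgue)"
    unfolding f_def[abs_def] case_prod_beta' using vm \<phi>m \<psi>m by (intro borel_measurable_times)
  have int_y: "integrable lebesgue (f x)" for x
    unfolding f_def[abs_def] using integrable_kernel[OF v \<phi>(1) \<rho>(1)]
    by (intro integrable_mult_left) auto
  have bound: "\<bar>f x y\<bar> \<le> m * M * \<bar>v y * indicator K y\<bar> * indicator (cball 0 R) x" for x y
  proof (cases "x \<in> cball 0 R \<and> y \<in> K")
    case True
    have "\<bar>v y\<bar> * (\<bar>\<phi> ((y - x) /\<^sub>R \<rho>)\<bar> * \<bar>\<psi> x\<bar>) \<le> \<bar>v y\<bar> * (m * M)"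
      using m M by (intro mult_left_mono mult_mono) auto
    then show ?thesis
      using True by (simp add: f_def abs_mult mult_ac)
  next
    case False
    then have "f x y = 0"
      using \<phi>K \<psi>(2) by (auto simp: f_def)
    then show ?thesis using m M by (simp add: zero_le_mult_iff)
  qed
  have int: "integrable (lebesgue \<Otimes>\<^sub>M lebesgue) (case_prod f)"
  proof (rule lb2.Fubini_integrable[OF fm])
    show "AE x in lebesgue. integrable lebesgue (\<lambda>y. case_prod f (x, y))"
      using int_y by simp
    show "integrable lebesgue (\<lambda>x. LINT y|lebesgue. norm (case_prod f (x, y)))"
    proof (rule Bochner_Integration.integrable_bound)
      define J where "J = (LINT y|lebesgue. m * M * \<bar>v y * indicator K y\<bar>)"
      show "integrable lebesgue (\<lambda>x. J * indicator (cball (0 :: real ^ 'n) R) x)"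
        using lmeasurable_iff_integrable[of "cball (0 :: real ^ 'n) R"] by (intro integrable_mult_right) auto
      have "(\<lambda>q. norm (case_prod f q)) \<in> borel_measurable (lebesgue \<Otimes>\<^sub>M lebesgue)"
        by (rule measurable_compose[OF fm borel_measurable_norm])
      then show "(\<lambda>x. LINT y|lebesgue. norm (case_prod f (x, y))) \<in> borel_measurable lebesgue"
        by (intro lb.borel_measurable_lebesgue_integral) (simp add: case_prod_beta')
      show "AE x in lebesgue. norm (LINT y|lebesgue. norm (case_prod f (x, y))) \<le>
          norm (J * indicator (cball (0 :: real ^ 'n) R) x)"
      proof (rule AE_I2)
        fix x
        have "(LINT y|lebesgue. \<bar>f x y\<bar>) \<le>
            (LINT y|lebesgue. m * M * \<bar>v y * indicator K y\<bar> * indicator (cball 0 R) x)"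
          using int_y v' bound by (intro integral_mono) auto
        also have "\<dots> = J * indicator (cball 0 R) x"
          by (simp add: J_def)
        finally show "norm (LINT y|lebesgue. norm (case_prod f (x, y))) \<le>
            norm (J * indicator (cball (0 :: real ^ 'n) R) x)"
          using Bochner_Integration.integral_nonneg[of lebesgue "\<lambda>y. \<bar>f x y\<bar>"] by simp
      qed
    qed
  qed
  have eq1: "dilate_avg \<phi> v x \<rho> * \<psi> x = (LINT y|lebesgue. f x y) / \<rho> ^ CARD('n)" for x
    by (simp add: dilate_avg_def f_def)
  have "integrable lebesgue (\<lambda>x. LINT y|lebesgue. f x y)"
    using lb2.integrable_fst[OF int] .
  then show "integrable lebesgue (\<lambda>x. dilate_avg \<phi> v x \<rho> * \<psi> x)"
    unfolding eq1 by simp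
  have inner: "(LINT x|lebesgue. f x y) = \<rho> ^ CARD('n) * (v y * (LINT z|lebesgue. \<phi> z * \<psi> (y + \<rho> *\<^sub>R z)))" for y
  proof -
    have "(\<lambda>z. y + \<rho> *\<^sub>R z) \<in> borel_measurable borel"
      by simp
    from measurable_compose[OF this elementary_measurable[OF \<psi>(1)]]
    have meas: "(\<lambda>z. \<phi> z * \<psi> (y + \<rho> *\<^sub>R z)) \<in> borel_measurable borel"
      by (rule borel_measurable_times[OF kernel_measurable(2)[OF \<phi>(1)]])
    \<comment> \<open>Evenness of \<open>\<phi>\<close> exchanges x and y; the substitution z = (x -
      y)/\<rho> then turns \<open>\<psi> x\<close> into \<open>\<psi>\<close> at y + \<rho>
      z.\<close>
    have "\<phi> ((y - x) /\<^sub>R \<rho>) * \<psi> x = \<phi> ((x - y) /\<^sub>R \<rho>) * \<psi> (y + \<rho> *\<^sub>R ((x - y) /\<^sub>R \<rho>))" for x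
      using \<phi>(2)[of "(x - y) /\<^sub>R \<rho>"] \<rho> by (simp flip: scaleR_minus_right)
    then have "f x y = v y * (\<phi> ((x - y) /\<^sub>R \<rho>) * \<psi> (y + \<rho> *\<^sub>R ((x - y) /\<^sub>R \<rho>)))" for x
      by (simp only: f_def mult.assoc)
    then have "(LINT x|lebesgue. f x y) =
        v y * (LINT x|lebesgue. \<phi> ((x - y) /\<^sub>R \<rho>) * \<psi> (y + \<rho> *\<^sub>R ((x - y) /\<^sub>R \<rho>)))"
      by (simp only: integral_mult_right_zero)
    then show ?thesis
      using integral_rescale[OF meas \<rho>(1), of y] by simp
  qed
  have "(LINT x|lebesgue. LINT y|lebesgue. f x y) = (LINT y|lebesgue. LINT x|lebesgue. f x y)"
    using lb2.Fubini_integral[OF int] by simp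
  then show "(LINT x|lebesgue. dilate_avg \<phi> v x \<rho> * \<psi> x) =
      (LINT y|lebesgue. v y * (LINT z|lebesgue. \<phi> z * \<psi> (y + \<rho> *\<^sub>R z)))"
    unfolding eq1 using \<rho> by (simp add: inner)
qed

text \<open>Dominated convergence is used twice: the averages of \<open>\<psi>\<close> converge at
  each point by continuity, and then their integrals against \<open>v\<close> converge, because
  these averages are uniformly bounded and supported in one ball.\<close>

lemma dilate_avg_tendsto_weakly:
  "(\<lambda>n. LINT x|lebesgue. dilate_avg \<phi> v x (1 / (real n + 1)) * \<psi> x)
    \<longlonglongrightarrow> (LINT y|lebesgue. \<phi> y) * (LINT y|lebesgue. v y * \<psi> y)"
proof -
  interpret lb: sigma_finite_measure "lebesgue :: (real ^ 'n) measure"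
    by (rule sigma_finite_lebesgue)
  obtain M where M: "M \<ge> 0" "\<And>x. \<bar>\<psi> x\<bar> \<le> M"
    using elementary_compact_support_bounded by blast
  define \<rho> where "\<rho> n = 1 / (real n + 1)" for n
  have \<rho>: "0 < \<rho> n" "\<rho> n \<le> 1" for n by (simp_all add: \<rho>_def)
  have \<rho>_lim: "\<rho> \<longlonglongrightarrow> 0"
    using LIMSEQ_inverse_real_of_nat unfolding \<rho>_def by (simp add: inverse_eq_divide add.commute)
  have \<phi>i: "integrable lebesgue \<phi>"
    by (rule integrable_kernel_self[OF \<phi>(1)])
  have \<phi>m: "\<phi> \<in> borel_measurable lebesgue"
    by (rule borel_measurable_integrable[OF \<phi>i])
  define k where "k n y = (LINT z|lebesgue. \<phi> z * \<psi> (y + \<rho> n *\<^sub>R z))" for n y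
  define C where "C = (LINT z|lebesgue. \<bar>\<phi> z\<bar> * M)"
  have comp: "(\<lambda>z. \<psi> (y + \<rho> n *\<^sub>R z)) \<in> borel_measurable lebesgue" for n y
    using measurable_compose[OF measurable_id_lebesgue, of "\<lambda>z. y + \<rho> n *\<^sub>R z" borel]
    by (intro measurable_compose[OF _ elementary_measurable[OF \<psi>(1)]]) simp
  have int: "integrable lebesgue (\<lambda>z. \<phi> z * \<psi> (y + \<rho> n *\<^sub>R z))" for n y
  proof (rule Bochner_Integration.integrable_bound)
    show "integrable lebesgue (\<lambda>z. \<bar>\<phi> z\<bar> * M)"
      using \<phi>i by auto
    show "AE z in lebesgue. norm (\<phi> z * \<psi> (y + \<rho> n *\<^sub>R z)) \<le> norm (\<bar>\<phi> z\<bar> * M)"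
      using M by (intro AE_I2) (auto simp: abs_mult intro!: mult_left_mono)
  qed (intro borel_measurable_times \<phi>m comp)
  have k_bound: "\<bar>k n y\<bar> \<le> C" for n y
  proof -
    have "\<bar>k n y\<bar> \<le> (LINT z|lebesgue. \<bar>\<phi> z * \<psi> (y + \<rho> n *\<^sub>R z)\<bar>)"
      unfolding k_def by (rule integral_abs_bound)
    also have "\<dots> \<le> C"
      unfolding C_def using M
      by (intro integral_mono integrable_abs int integrable_mult_left \<phi>i)
         (auto simp: abs_mult intro!: mult_left_mono)
    finally show ?thesis .
  qed
  have k_zero: "k n y = 0" if "y \<notin> cball 0 (R + 1)" for n y
  proof -
    have "\<phi> z * \<psi> (y + \<rho> n *\<^sub>R z) = 0" for z
    proof (cases "norm z > 1")
      case False
      have "norm (\<rho> n *\<^sub>R z) \<le> 1"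
        using False \<rho>[of n] mult_mono[of "\<rho> n" 1 "norm z" 1] by simp
      moreover have "norm y \<le> norm (y + \<rho> n *\<^sub>R z) + norm (\<rho> n *\<^sub>R z)"
        using norm_triangle_ineq4[of "y + \<rho> n *\<^sub>R z" "\<rho> n *\<^sub>R z"] by simp
      ultimately show ?thesis
        using that \<psi>(2)[of "y + \<rho> n *\<^sub>R z"] by simp
    qed (use \<phi>(1) in \<open>simp add: kernel_def\<close>)
    then show ?thesis by (simp only: k_def Bochner_Integration.integral_zero)
  qed
  have k_meas: "k n \<in> borel_measurable lebesgue" for n
  proof -
    have "(\<lambda>q. fst q + \<rho> n *\<^sub>R snd q) \<in> borel_measurable (lebesgue \<Otimes>\<^sub>M lebesgue)"
      using measurable_fst_lebesgue measurable_snd_lebesgue by (intro borel_measurable_scaleR borel_measurable_add) auto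
    then have "(\<lambda>q. \<phi> (snd q) * \<psi> (fst q + \<rho> n *\<^sub>R snd q)) \<in> borel_measurable (lebesgue \<Otimes>\<^sub>M lebesgue)"
      by (intro borel_measurable_times measurable_compose[OF _ elementary_measurable[OF \<psi>(1)]]
          measurable_compose[OF measurable_snd_lebesgue kernel_measurable(2)[OF \<phi>(1)]])
    then show ?thesis
      unfolding k_def[abs_def]
      by (intro lb.borel_measurable_lebesgue_integral) (simp add: case_prod_beta')
  qed
  have k_lim: "(\<lambda>n. k n y) \<longlonglongrightarrow> (LINT z|lebesgue. \<phi> z) * \<psi> y" for y
  proof -
    have "(\<lambda>n. k n y) \<longlonglongrightarrow> (LINT z|lebesgue. \<phi> z * \<psi> y)"
      unfolding k_def
    proof (rule integral_dominated_convergence[where w="\<lambda>z. \<bar>\<phi> z\<bar> * M"])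
      show "integrable lebesgue (\<lambda>z. \<bar>\<phi> z\<bar> * M)"
        using \<phi>i by auto
      show "AE z in lebesgue. norm (\<phi> z * \<psi> (y + \<rho> n *\<^sub>R z)) \<le> \<bar>\<phi> z\<bar> * M" for n
        using M by (intro AE_I2) (auto simp: abs_mult intro!: mult_left_mono)
      show "AE z in lebesgue. (\<lambda>n. \<phi> z * \<psi> (y + \<rho> n *\<^sub>R z)) \<longlonglongrightarrow> \<phi> z * \<psi> y"
      proof (intro AE_I2 tendsto_mult_left)
        fix z
        have "(\<lambda>n. y + \<rho> n *\<^sub>R z) \<longlonglongrightarrow> y + 0 *\<^sub>R z"
          by (intro tendsto_intros \<rho>_lim)
        then have "(\<lambda>n. y + \<rho> n *\<^sub>R z) \<longlonglongrightarrow> y" by simp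
        moreover have "isCont \<psi> y"
          using elementary_continuous[OF \<psi>(1), of UNIV] by (simp add: continuous_on_eq_continuous_at)
        ultimately show "(\<lambda>n. \<psi> (y + \<rho> n *\<^sub>R z)) \<longlonglongrightarrow> \<psi> y"
          by (rule isCont_tendsto_compose[rotated])
      qed
    qed (use \<phi>m comp in auto)
    then show ?thesis by simp
  qed
  have "(\<lambda>n. LINT y|lebesgue. v y * k n y) \<longlonglongrightarrow>
      (LINT y|lebesgue. v y * ((LINT z|lebesgue. \<phi> z) * \<psi> y))"
  proof (rule integral_dominated_convergence[where w="\<lambda>y. C * \<bar>v y * indicator (cball 0 (R + 1)) y\<bar>"])
    have vm: "v \<in> borel_measurable lebesgue"
      by (rule locally_integrable_measurable[OF v])
    show "(\<lambda>y. v y * k n y) \<in> borel_measurable lebesgue" for n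
      by (intro borel_measurable_times vm k_meas)
    have "\<psi> \<in> borel_measurable lebesgue"
      using measurable_compose[OF measurable_id_lebesgue elementary_measurable[OF \<psi>(1)]] by simp
    then show "(\<lambda>y. v y * ((LINT z|lebesgue. \<phi> z) * \<psi> y)) \<in> borel_measurable lebesgue"
      by (intro borel_measurable_times vm) auto
    show "integrable lebesgue (\<lambda>y. C * \<bar>v y * indicator (cball 0 (R + 1)) y\<bar>)"
      by (intro integrable_mult_right integrable_abs locally_integrable_indicator_bounded[OF v]) auto
    show "AE y in lebesgue. (\<lambda>n. v y * k n y) \<longlonglongrightarrow> v y * ((LINT z|lebesgue. \<phi> z) * \<psi> y)"
      by (intro AE_I2 tendsto_mult_left k_lim)
    show "AE y in lebesgue. norm (v y * k n y) \<le> C * \<bar>v y * indicator (cball 0 (R + 1)) y\<bar>" for n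
    proof (rule AE_I2)
      fix y
      show "norm (v y * k n y) \<le> C * \<bar>v y * indicator (cball 0 (R + 1)) y\<bar>"
        using k_zero[of y n] mult_right_mono[OF k_bound[of n y], of "\<bar>v y\<bar>"]
        by (cases "y \<in> cball 0 (R + 1)") (auto simp: abs_mult mult.commute)
    qed
  qed
  moreover have "(LINT y|lebesgue. v y * k n y) = (LINT x|lebesgue. dilate_avg \<phi> v x (\<rho> n) * \<psi> x)" for n
    unfolding k_def using fubini_dilate_avg(2)[OF \<rho>] by simp
  moreover have "(LINT y|lebesgue. v y * ((LINT z|lebesgue. \<phi> z) * \<psi> y)) =
      (LINT y|lebesgue. \<phi> y) * (LINT y|lebesgue. v y * \<psi> y)"
    by (simp add: mult.left_commute[of "v _"])
  ultimately show ?thesis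
    by (simp add: \<rho>_def)
qed

end

text \<open>Each scale gives an integral inequality that survives the weak limit. The kernel is not
  normalised, so its integral remains as a factor.\<close>

lemma dilate_avg_bound_imp_le:
  fixes \<phi> v H :: "real ^ 'n \<Rightarrow> real"
  assumes \<phi>: "kernel \<phi>" "\<And>y. \<phi> (- y) = \<phi> y"
    and v: "locally_integrable v" and H: "locally_integrable H"
    and bound: "AE x in lebesgue. \<forall>\<rho>. 0 < \<rho> \<longrightarrow> \<rho> \<le> 1 \<longrightarrow> dilate_avg \<phi> v x \<rho> \<le> H x"
  shows "AE x in lebesgue. (LINT y|lebesgue. \<phi> y) * v x \<le> H x"
proof -
  define c where "c = (LINT y|lebesgue. \<phi> y)"
  have "AE x in lebesgue. 0 \<le> H x + (- c) * v x"
  proof (rule AE_nonneg_of_test_functions)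
    show "locally_integrable (\<lambda>x. H x + (- c) * v x)"
      by (intro locally_integrable_add locally_integrable_cmult v H)
    fix \<psi> :: "real ^ 'n \<Rightarrow> real"
    assume \<psi>: "\<psi> \<in> elementary" "test_function \<psi>" "\<And>x. 0 \<le> \<psi> x"
    have "bounded (closure {x. \<psi> x \<noteq> 0})"
      using \<psi>(2) compact_imp_bounded by (auto simp: test_function_def)
    then obtain R where R: "closure {x. \<psi> x \<noteq> 0} \<subseteq> cball 0 R"
      using bounded_subset_ballD[of _ 0] ball_subset_cball by (metis order_trans)
    have zero: "\<psi> x = 0" if "x \<notin> cball 0 R" for x
      using that R closure_subset[of "{x. \<psi> x \<noteq> 0}"] by blast
    obtain M where M: "M \<ge> 0" "\<And>x. \<bar>\<psi> x\<bar> \<le> M"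
      using elementary_compact_support_bounded[OF \<phi> \<psi>(1) zero v] by blast
    have \<psi>m: "\<psi> \<in> borel_measurable lebesgue"
      using measurable_compose[OF measurable_id_lebesgue elementary_measurable[OF \<psi>(1)]] by simp
    have int: "integrable lebesgue (\<lambda>x. w x * \<psi> x)" if "locally_integrable w" for w
      by (rule integrable_mult_compact_support[OF that compact_cball[of 0 R] \<psi>m M(2) zero])
    have "(LINT x|lebesgue. dilate_avg \<phi> v x (1 / (real n + 1)) * \<psi> x) \<le> (LINT x|lebesgue. H x * \<psi> x)" for n
    proof (rule integral_mono_AE)
      show "integrable lebesgue (\<lambda>x. dilate_avg \<phi> v x (1 / (real n + 1)) * \<psi> x)"
        by (rule fubini_dilate_avg(1)[OF \<phi> \<psi>(1) zero v]) auto
      show "AE x in lebesgue. dilate_avg \<phi> v x (1 / (real n + 1)) * \<psi> x \<le> H x * \<psi> x"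
        using bound by eventually_elim (use \<psi>(3) in \<open>auto intro!: mult_right_mono\<close>)
    qed (rule int[OF H])
    then have "c * (LINT y|lebesgue. v y * \<psi> y) \<le> (LINT x|lebesgue. H x * \<psi> x)"
      unfolding c_def by (intro LIMSEQ_le_const2[OF dilate_avg_tendsto_weakly[OF \<phi> \<psi>(1) zero v]]) auto
    then show "0 \<le> (LINT x|lebesgue. (H x + (- c) * v x) * \<psi> x)"
      using int[OF H] int[OF v] by (simp add: left_diff_distrib mult.assoc)
  qed
  then show ?thesis
    by (simp add: c_def)
qed

lemma dilate_avg_bound_imp_abs_le:
  fixes \<phi> v H :: "real ^ 'n \<Rightarrow> real"
  assumes \<phi>: "kernel \<phi>" "\<And>y. \<phi> (- y) = \<phi> y"
    and v: "locally_integrable v" and H: "locally_integrable H"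
    and bound: "AE x in lebesgue. \<forall>\<rho>. 0 < \<rho> \<longrightarrow> \<rho> \<le> 1 \<longrightarrow> \<bar>dilate_avg \<phi> v x \<rho>\<bar> \<le> H x"
  shows "AE x in lebesgue. (LINT y|lebesgue. \<phi> y) * \<bar>v x\<bar> \<le> H x"
proof -
  have neg: "dilate_avg \<phi> (\<lambda>x. - v x) x \<rho> = - dilate_avg \<phi> v x \<rho>" for x \<rho>
    by (simp add: dilate_avg_def)
  have "AE x in lebesgue. (LINT y|lebesgue. \<phi> y) * v x \<le> H x"
    by (rule dilate_avg_bound_imp_le[OF \<phi> v H]) (use bound in eventually_elim, force)
  moreover have "AE x in lebesgue. (LINT y|lebesgue. \<phi> y) * (- v x) \<le> H x"
  proof (rule dilate_avg_bound_imp_le[OF \<phi> _ H])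
    show "locally_integrable (\<lambda>x. - v x)"
      using locally_integrable_cmult[OF v, of "-1"] by simp
    show "AE x in lebesgue. \<forall>\<rho>. 0 < \<rho> \<longrightarrow> \<rho> \<le> 1 \<longrightarrow> dilate_avg \<phi> (\<lambda>x. - v x) x \<rho> \<le> H x"
      using bound by eventually_elim (force simp: neg)
  qed
  ultimately show ?thesis
    by eventually_elim (auto simp: abs_if)
qed

subsection \<open>The inner Gagliardo integral\<close>

lemma locally_integrable_dominated:
  fixes f h :: "real ^ 'n \<Rightarrow> real"
  assumes f: "f \<in> borel_measurable lebesgue" and h: "integrable lebesgue h"
    and le: "\<And>x. \<bar>f x\<bar> \<le> c + h x"
  shows "locally_integrable f"
  unfolding locally_integrable_def set_integrable_def
proof (intro allI impI)
  fix K :: "(real ^ 'n) set" assume K: "compact K"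
  have K': "K \<in> sets lebesgue" "integrable lebesgue (indicator K :: _ \<Rightarrow> real)"
    using K lmeasurable_compact[OF K] lmeasurable_iff_integrable[of K] by auto
  show "integrable lebesgue (\<lambda>x. indicator K x *\<^sub>R f x)"
  proof (rule Bochner_Integration.integrable_bound)
    show "integrable lebesgue (\<lambda>x. c * indicator K x + h x)"
      using K' h by auto
    show "AE x in lebesgue. norm (indicator K x *\<^sub>R f x) \<le> norm (c * indicator K x + h x)"
    proof (rule AE_I2)
      fix x show "norm (indicator K x *\<^sub>R f x) \<le> norm (c * indicator K x + h x)"
        using le[of x] by (cases "x \<in> K") auto
    qed
  qed (use f K' in measurable)
qed

lemma powr_le_one_plus:
  fixes t a :: real
  assumes "0 \<le> t" "0 \<le> a" "a \<le> 1"
  shows "t powr a \<le> 1 + t"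
proof (cases "t \<le> 1")
  case True
  then show ?thesis
    using assms powr_le1[of a t] by simp
next
  case False
  then show ?thesis
    using assms powr_mono[of a 1 t] by simp
qed

lemma powr_plus_one_le:
  fixes t a :: real
  assumes "0 \<le> t" "0 \<le> a" "a \<le> 1"
  shows "(t + 1) powr a \<le> 2 * (1 + t powr a)"
proof -
  have two: "2 powr a \<le> (2 :: real)"
    using powr_mono[of a 1 "2 :: real"] assms by simp
  show ?thesis
  proof (cases "t \<le> 1")
    case True
    then have "(t + 1) powr a \<le> 2 powr a"
      using assms by (intro powr_mono2) auto
    with two have "(t + 1) powr a \<le> 2"
      by (rule order_trans[rotated])
    then show ?thesis
      by (simp add: distrib_left add_increasing2)
  next
    case False
    then have "(t + 1) powr a \<le> (2 * t) powr a"
      using assms by (intro powr_mono2) auto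
    also have "\<dots> = 2 powr a * t powr a"
      using assms by (simp add: powr_mult)
    also have "\<dots> \<le> 2 * t powr a"
      using two by (rule mult_right_mono) simp
    finally show ?thesis by simp
  qed
qed

text \<open>\<open>enn2real\<close> sends an infinite density to 0, so the root bounds the density
  only at points where the latter is finite; for \<open>regular\<close> functions this is almost
  everywhere.\<close>

definition gagliardo_root :: "nat \<Rightarrow> real \<Rightarrow> real \<Rightarrow> (real ^ 'n \<Rightarrow> real) \<Rightarrow> real ^ 'n \<Rightarrow> real" where
  "gagliardo_root k \<sigma> p u x = enn2real (gagliardo_density k \<sigma> p u x) powr (1 / p)"

text \<open>What the pointwise bounds at positive order take from membership in the fractional space
  and in BMO, phrased with separate k and \<sigma>. Membership in L^p is left out and enters as an
  extra assumption at the lower orders.\<close>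

definition regular :: "nat \<Rightarrow> real \<Rightarrow> real \<Rightarrow> (real ^ 'n \<Rightarrow> real) \<Rightarrow> bool" where
  "regular k \<sigma> p u \<longleftrightarrow>
     (\<forall>is. length is \<le> k \<longrightarrow> has_weak_deriv u is (weak_deriv u is)) \<and>
     (\<integral>\<^sup>+ x. gagliardo_density k \<sigma> p u x \<partial>lebesgue) < \<infinity> \<and> bmo_oscillation u < \<infinity>"

context
  fixes k :: nat and \<sigma> p :: real and u :: "real ^ 'n \<Rightarrow> real"
  assumes reg: "regular k \<sigma> p u" and p: "p \<ge> 1"
begin

lemma regular_weak_deriv:
  "length is \<le> k \<Longrightarrow> has_weak_deriv u is (weak_deriv u is)"
  "length is \<le> k \<Longrightarrow> locally_integrable (weak_deriv u is)"
  "length is \<le> k \<Longrightarrow> weak_deriv u is \<in> borel_measurable lebesgue"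
  using reg has_weak_deriv_locally_integrable(2)[of u "is"] locally_integrable_measurable
  by (auto simp: regular_def)

text \<open>The weak derivatives are Lebesgue measurable, so joint measurability is taken in the
  product of two copies of \<open>lebesgue\<close> and the inner integral is measurable by
  Tonelli.\<close>

lemma gagliardo_density_measurable: "gagliardo_density k \<sigma> p u \<in> borel_measurable lebesgue"
proof -
  interpret lb: sigma_finite_measure "lebesgue :: (real ^ 'n) measure"
    by (rule sigma_finite_lebesgue)
  have diff: "(\<lambda>q. weak_deriv u is (snd q) - weak_deriv u is (fst q)) \<in> borel_measurable (lebesgue \<Otimes>\<^sub>M lebesgue)"
    if "length is = k" for "is"
    using that regular_weak_deriv(3)[of "is"]
    by (intro borel_measurable_diff measurable_compose[OF measurable_snd] measurable_compose[OF measurable_fst]) auto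
  have T: "(\<lambda>q. tensor_norm k (\<lambda>is. weak_deriv u is (snd q) - weak_deriv u is (fst q))) \<in> borel_measurable (lebesgue \<Otimes>\<^sub>M lebesgue)"
  proof -
    have "(\<lambda>q. \<Sum>is | length is = k. (weak_deriv u is (snd q) - weak_deriv u is (fst q))\<^sup>2) \<in> borel_measurable (lebesgue \<Otimes>\<^sub>M lebesgue)"
      by (intro borel_measurable_sum borel_measurable_power diff) simp
    then show ?thesis
      unfolding tensor_norm_def L2_set_def by measurable
  qed
  have N: "(\<lambda>q. norm (snd q - fst q :: real ^ 'n)) \<in> borel_measurable (lebesgue \<Otimes>\<^sub>M lebesgue)"
    using measurable_fst_lebesgue measurable_snd_lebesgue
    by (intro measurable_compose[OF borel_measurable_diff borel_measurable_norm])
  have "(\<lambda>q. ennreal (tensor_norm k (\<lambda>is. weak_deriv u is (snd q) - weak_deriv u is (fst q)) powr p /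
       norm (snd q - fst q) powr (real CARD('n) + \<sigma> * p))) \<in> borel_measurable (lebesgue \<Otimes>\<^sub>M lebesgue)"
    using T N by measurable
  then show ?thesis
    unfolding gagliardo_density_def[abs_def]
    by (intro lb.borel_measurable_nn_integral) (simp add: case_prod_beta')
qed

lemma gagliardo_density_finite: "AE x in lebesgue. gagliardo_density k \<sigma> p u x < \<infinity>"
  using nn_integral_PInf_AE[OF gagliardo_density_measurable] reg
  by (auto simp: regular_def less_top)

lemma gagliardo_root_powr: "gagliardo_root k \<sigma> p u x powr p = enn2real (gagliardo_density k \<sigma> p u x)"
  using p by (simp add: gagliardo_root_def powr_powr)

lemma gagliardo_root_nonneg: "gagliardo_root k \<sigma> p u x \<ge> 0"
  by (simp add: gagliardo_root_def)

lemma gagliardo_root_measurable: "gagliardo_root k \<sigma> p u \<in> borel_measurable lebesgue"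
  unfolding gagliardo_root_def[abs_def]
  using gagliardo_density_measurable by measurable

lemma integral_gagliardo_root_powr:
  "integrable lebesgue (\<lambda>x. gagliardo_root k \<sigma> p u x powr p)"
  "(LINT x|lebesgue. gagliardo_root k \<sigma> p u x powr p) =
    enn2real (\<integral>\<^sup>+ x. gagliardo_density k \<sigma> p u x \<partial>lebesgue)"
proof -
  have m: "(\<lambda>x. enn2real (gagliardo_density k \<sigma> p u x)) \<in> borel_measurable lebesgue"
    using gagliardo_density_measurable by measurable
  have "(\<integral>\<^sup>+ x. ennreal (enn2real (gagliardo_density k \<sigma> p u x)) \<partial>lebesgue) =
      (\<integral>\<^sup>+ x. gagliardo_density k \<sigma> p u x \<partial>lebesgue)"
    by (rule nn_integral_cong_AE) (use gagliardo_density_finite in eventually_elim, simp)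
  moreover from this show "integrable lebesgue (\<lambda>x. gagliardo_root k \<sigma> p u x powr p)"
    unfolding gagliardo_root_powr using m reg
    by (intro integrableI_nonneg) (auto simp: regular_def)
  ultimately show "(LINT x|lebesgue. gagliardo_root k \<sigma> p u x powr p) =
    enn2real (\<integral>\<^sup>+ x. gagliardo_density k \<sigma> p u x \<partial>lebesgue)"
    unfolding gagliardo_root_powr using m by (simp add: integral_eq_nn_integral)
qed

lemma controlled_regular:
  assumes "gagliardo_density k \<sigma> p u x < \<infinity>" "\<epsilon> > 0"
  shows "controlled k \<sigma> p u (bmo_seminorm u + \<epsilon>) x (gagliardo_root k \<sigma> p u x + \<epsilon>)"
  unfolding controlled_def
proof (intro conjI allI impI regular_weak_deriv(1))
  have "bmo_oscillation u = ennreal (bmo_seminorm u)"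
    using reg by (simp add: bmo_seminorm_def regular_def)
  also have "\<dots> \<le> ennreal (bmo_seminorm u + \<epsilon>)"
    using assms by (intro ennreal_leI) auto
  finally show "bmo_oscillation u \<le> ennreal (bmo_seminorm u + \<epsilon>)" .
  have "gagliardo_density k \<sigma> p u x = ennreal (gagliardo_root k \<sigma> p u x powr p)"
    using assms by (simp add: gagliardo_root_powr)
  also have "\<dots> \<le> ennreal ((gagliardo_root k \<sigma> p u x + \<epsilon>) powr p)"
    using assms p gagliardo_root_nonneg by (intro ennreal_leI powr_mono2) auto
  finally show "gagliardo_density k \<sigma> p u x \<le> ennreal ((gagliardo_root k \<sigma> p u x + \<epsilon>) powr p)" .
  show "0 < bmo_seminorm u + \<epsilon>" "0 < gagliardo_root k \<sigma> p u x + \<epsilon>"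
    using assms gagliardo_root_nonneg[of x] enn2real_nonneg[of "bmo_oscillation u"]
    by (auto simp: bmo_seminorm_def intro: add_nonneg_pos)
qed

text \<open>Provides the local integrability of the majorants to which averages are compared. As a
  <= 1 <= p, the power is at most a constant plus the integrable function g^p.\<close>

lemma locally_integrable_gagliardo_root:
  assumes "0 \<le> a" "a \<le> 1" "0 \<le> \<epsilon>" "0 \<le> c"
  shows "locally_integrable (\<lambda>x. c * (gagliardo_root k \<sigma> p u x + \<epsilon>) powr a)"
proof (rule locally_integrable_dominated)
  let ?g = "gagliardo_root k \<sigma> p u"
  show "(\<lambda>x. c * (?g x + \<epsilon>) powr a) \<in> borel_measurable lebesgue"
    using gagliardo_root_measurable by measurable
  show "integrable lebesgue (\<lambda>x. c * ?g x powr p)"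
    by (intro integrable_mult_right integral_gagliardo_root_powr)
  fix x
  have g0: "?g x \<ge> 0" by (rule gagliardo_root_nonneg)
  have "?g x \<le> 1 + ?g x powr p"
    using powr_le_one_plus[of "?g x powr p" "1 / p"] p g0 by (simp add: powr_powr)
  moreover have "(?g x + \<epsilon>) powr a \<le> 1 + (?g x + \<epsilon>)"
    using assms g0 by (intro powr_le_one_plus) auto
  ultimately have "(?g x + \<epsilon>) powr a \<le> 2 + \<epsilon> + ?g x powr p"
    by linarith
  then have "c * (?g x + \<epsilon>) powr a \<le> c * (2 + \<epsilon> + ?g x powr p)"
    using assms(4) by (rule mult_left_mono)
  then show "\<bar>c * (?g x + \<epsilon>) powr a\<bar> \<le> c * (2 + \<epsilon>) + c * ?g x powr p"
    using assms by (simp add: abs_mult distrib_left)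
qed

end

subsection \<open>Pointwise bounds on the weak derivatives\<close>

text \<open>The positive majorants are taken with \<epsilon> = 1/(n+1), so only countably many null
  sets are discarded. Both exponents are positive because 1 <= j <= k < s, which makes the powers
  continuous at 0 and covers a vanishing semi-norm in the limit.\<close>

lemma weak_deriv_pointwise_bound:
  assumes p: "p \<ge> 1" and \<sigma>: "\<sigma> > 0" and len: "length (is :: 'n::finite list) = j" "1 \<le> j" "j \<le> k"
    and s: "s = real k + \<sigma>"
  shows "\<exists>C\<ge>0. \<forall>u :: real ^ 'n \<Rightarrow> real. regular k \<sigma> p u \<longrightarrow> (AE x in lebesgue.
    \<bar>weak_deriv u is x\<bar> \<le> C * (bmo_seminorm u powr (1 - real j / s) * gagliardo_root k \<sigma> p u x powr (real j / s)))"
proof -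
  define c where "c = (LINT y|lebesgue. (unit_bump (y :: real ^ 'n) :: real))"
  have c: "c > 0" using integral_unit_bump_pos unfolding c_def .
  obtain C where C: "C \<ge> 0" "\<And>u b x g \<rho>. controlled k \<sigma> p u b x g \<Longrightarrow> 0 < \<rho> \<Longrightarrow>
    \<bar>dilate_avg unit_bump (weak_deriv u is) x \<rho>\<bar> \<le> C * (b powr (1 - real j / s) * g powr (real j / s))"
    using dilate_avg_interpolation[OF p \<sigma> unit_bump_kernel len s] by blast
  have s0: "s > 0" and js: "0 < real j / s" "real j / s < 1"
    using \<sigma> s len by auto
  show ?thesis
  proof (intro exI[of _ "C / c"] conjI allI impI)
    fix u :: "real ^ 'n \<Rightarrow> real" assume reg: "regular k \<sigma> p u"
    let ?g = "gagliardo_root k \<sigma> p u" and ?b = "bmo_seminorm u"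
    have b0: "?b \<ge> 0" by (simp add: bmo_seminorm_def)
    define \<epsilon> where "\<epsilon> n = 1 / (real n + 1)" for n
    have \<epsilon>: "\<epsilon> n > 0" for n by (simp add: \<epsilon>_def)
    have \<epsilon>_lim: "\<epsilon> \<longlonglongrightarrow> 0"
      using LIMSEQ_inverse_real_of_nat unfolding \<epsilon>_def by (simp add: inverse_eq_divide add.commute)
    have "AE x in lebesgue. c * \<bar>weak_deriv u is x\<bar> \<le>
        (C * (?b + \<epsilon> n) powr (1 - real j / s)) * (?g x + \<epsilon> n) powr (real j / s)" for n
      unfolding c_def
    proof (rule dilate_avg_bound_imp_abs_le[OF unit_bump_kernel unit_bump_even])
      show "locally_integrable (weak_deriv u is)"
        using regular_weak_deriv(2)[OF reg p] len by simp
      show "locally_integrable (\<lambda>x. (C * (?b + \<epsilon> n) powr (1 - real j / s)) * (?g x + \<epsilon> n) powr (real j / s))"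
        using js \<epsilon>[of n] C(1) by (intro locally_integrable_gagliardo_root[OF reg p]) auto
      show "AE x in lebesgue. \<forall>\<rho>. 0 < \<rho> \<longrightarrow> \<rho> \<le> 1 \<longrightarrow> \<bar>dilate_avg unit_bump (weak_deriv u is) x \<rho>\<bar>
          \<le> (C * (?b + \<epsilon> n) powr (1 - real j / s)) * (?g x + \<epsilon> n) powr (real j / s)"
        using gagliardo_density_finite[OF reg p]
      proof eventually_elim
        case (elim x)
        show ?case
          using C(2)[OF controlled_regular[OF reg p elim \<epsilon>]] by (simp add: mult.assoc)
      qed
    qed
    then have "AE x in lebesgue. \<forall>n. c * \<bar>weak_deriv u is x\<bar> \<le>
        (C * (?b + \<epsilon> n) powr (1 - real j / s)) * (?g x + \<epsilon> n) powr (real j / s)"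
      by (subst AE_all_countable) blast
    then show "AE x in lebesgue. \<bar>weak_deriv u is x\<bar> \<le>
        C / c * (?b powr (1 - real j / s) * ?g x powr (real j / s))"
    proof eventually_elim
      case (elim x)
      have g0: "?g x \<ge> 0" by (rule gagliardo_root_nonneg[OF reg p])
      have plim: "(\<lambda>n. (t + \<epsilon> n) powr a) \<longlonglongrightarrow> (t + 0) powr a" if "t \<ge> 0" "a > 0" for t a
        using that \<epsilon> by (intro tendsto_powr' tendsto_intros \<epsilon>_lim) (auto simp: less_imp_le add_nonneg_nonneg)
      have "(\<lambda>n. (C * (?b + \<epsilon> n) powr (1 - real j / s)) * (?g x + \<epsilon> n) powr (real j / s))
          \<longlonglongrightarrow> (C * (?b + 0) powr (1 - real j / s)) * (?g x + 0) powr (real j / s)"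
        using js b0 g0 by (intro tendsto_mult tendsto_const plim) auto
      from LIMSEQ_le_const[OF this] elim
      have "c * \<bar>weak_deriv u is x\<bar> \<le> C * (?b powr (1 - real j / s) * ?g x powr (real j / s))"
        by (auto simp: mult.assoc)
      then show ?case
        using c by (simp add: field_simps)
    qed
  qed (use C c in auto)
qed

section \<open>Membership in the target Lebesgue space, including the lower orders\<close>

lemma Lp_spaceI_dominated:
  fixes f h :: "real ^ 'n \<Rightarrow> real"
  assumes f: "f \<in> Lp_space p" and h: "h \<in> borel_measurable lebesgue" "\<And>x. h x \<ge> 0" "integrable lebesgue (\<lambda>x. h x powr q)"
    and pq: "0 < p" "p \<le> q" and K: "K \<ge> 0" and le: "AE x in lebesgue. \<bar>f x\<bar> \<le> K + h x"
  shows "f \<in> Lp_space q"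
proof -
  have fm: "f \<in> borel_measurable lebesgue" and fi: "integrable lebesgue (\<lambda>x. \<bar>f x\<bar> powr p)"
    using f by (simp_all add: Lp_space_def)
  have "integrable lebesgue (\<lambda>x. \<bar>f x\<bar> powr q)"
  proof (rule Bochner_Integration.integrable_bound)
    show "integrable lebesgue (\<lambda>x. (2 * K) powr (q - p) * \<bar>f x\<bar> powr p + 2 powr q * h x powr q)"
      using fi h(3) by auto
    show "(\<lambda>x. \<bar>f x\<bar> powr q) \<in> borel_measurable lebesgue"
      using fm by measurable
    show "AE x in lebesgue. norm (\<bar>f x\<bar> powr q) \<le>
        norm ((2 * K) powr (q - p) * \<bar>f x\<bar> powr p + 2 powr q * h x powr q)"
      using le
    proof eventually_elim
      case (elim x)
      have "\<bar>f x\<bar> powr q \<le> (2 * K) powr (q - p) * \<bar>f x\<bar> powr p + 2 powr q * h x powr q"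
      \<comment> \<open>Where f is at most 2 K, the excess power q - p is bounded by that of 2 K.
        Elsewhere K is less than half of f and can be absorbed, leaving f <= 2 h.\<close>
      proof (cases "\<bar>f x\<bar> \<le> 2 * K")
        case True
        have "\<bar>f x\<bar> powr q = \<bar>f x\<bar> powr (q - p) * \<bar>f x\<bar> powr p"
          by (simp flip: powr_add)
        also have "\<dots> \<le> (2 * K) powr (q - p) * \<bar>f x\<bar> powr p"
          using True pq by (intro mult_right_mono powr_mono2) auto
        finally show ?thesis
          by (simp add: add_increasing2)
      next
        case False
        then have "\<bar>f x\<bar> \<le> 2 * h x" using elim by linarith
        then have "\<bar>f x\<bar> powr q \<le> (2 * h x) powr q"
          using pq by (intro powr_mono2) auto
        then show ?thesis
          using h(2)[of x] by (simp add: powr_mult add_increasing)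
      qed
      then show ?case by simp
    qed
  qed
  then show ?thesis
    using fm by (simp add: Lp_space_def)
qed

text \<open>On the support of the kernel the absolute value of v is at most 1 plus its p-th power,
  and both integrate to a bound uniform in x. This anchors the order-zero estimate at scale
  1.\<close>

lemma dilate_avg_Lp_bounded:
  fixes L v :: "real ^ 'n \<Rightarrow> real"
  assumes L: "kernel L" and v: "v \<in> Lp_space p" "locally_integrable v" and p: "p \<ge> 1"
  shows "\<exists>A. \<forall>x. \<bar>dilate_avg L v x 1\<bar> \<le> A"
proof -
  obtain m where m: "m \<ge> 0" "\<And>x. \<bar>L x\<bar> \<le> m"
    using kernel_bounded[OF L] by blast
  have vi: "integrable lebesgue (\<lambda>y. \<bar>v y\<bar> powr p)"
    using v by (simp add: Lp_space_def)
  have "\<bar>dilate_avg L v x 1\<bar> \<le> m * (unit_ball_vol (real CARD('n)) + (LINT y|lebesgue. \<bar>v y\<bar> powr p))" for x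
  proof -
    have ind: "integrable lebesgue (indicator (cball x 1) :: _ \<Rightarrow> real)"
      using lmeasurable_iff_integrable[of "cball x 1"] by simp
    have "\<bar>dilate_avg L v x 1\<bar> \<le> (LINT y|lebesgue. \<bar>v y * L ((y - x) /\<^sub>R 1)\<bar>)"
      unfolding dilate_avg_def power_one div_by_1 by (rule integral_abs_bound)
    also have "\<dots> \<le> (LINT y|lebesgue. m * (indicator (cball x 1) y + \<bar>v y\<bar> powr p))"
    proof (rule integral_mono)
      show "integrable lebesgue (\<lambda>y. \<bar>v y * L ((y - x) /\<^sub>R 1)\<bar>)"
        by (intro integrable_abs integrable_kernel v L) simp
      show "integrable lebesgue (\<lambda>y. m * (indicator (cball x 1) y + \<bar>v y\<bar> powr p))"
        using ind vi by (intro integrable_mult_right Bochner_Integration.integrable_add)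
      fix y
      show "\<bar>v y * L ((y - x) /\<^sub>R 1)\<bar> \<le> m * (indicator (cball x 1) y + \<bar>v y\<bar> powr p)"
      proof (cases "y \<in> cball x 1")
        case True
        have "\<bar>v y\<bar> \<le> 1 + \<bar>v y\<bar> powr p"
          using powr_le_one_plus[of "\<bar>v y\<bar> powr p" "1 / p"] p by (simp add: powr_powr)
        then have "\<bar>L ((y - x) /\<^sub>R 1)\<bar> * \<bar>v y\<bar> \<le> m * (1 + \<bar>v y\<bar> powr p)"
          using m by (intro mult_mono) auto
        then show ?thesis
          using True by (simp add: abs_mult mult.commute)
      next
        case False
        then show ?thesis
          using kernel_rescale_zero[OF L, of 1 y x] m by simp
      qed
    qed
    also have "\<dots> = m * (unit_ball_vol (real CARD('n)) + (LINT y|lebesgue. \<bar>v y\<bar> powr p))"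
      using ind vi content_cball[of 1 x] by simp
    finally show ?thesis .
  qed
  then show ?thesis by blast
qed

text \<open>Only membership in L^(s p / l) rests on this bound, so \<open>K\<close> may depend on
  \<open>u\<close>. The exponent is l/s at every order, so that the majorant has an integrable power
  s p / l.\<close>

lemma weak_deriv_lower_order_bound:
  fixes u :: "real ^ 'n \<Rightarrow> real"
  assumes p: "p \<ge> 1" and \<sigma>: "\<sigma> > 0" and reg: "regular k \<sigma> p u"
    and len: "length is \<le> l" "1 \<le> l" "l \<le> k" and s: "s = real k + \<sigma>"
    and Lp: "weak_deriv u is \<in> Lp_space p"
  shows "\<exists>K\<ge>0. AE x in lebesgue. \<bar>weak_deriv u is x\<bar> \<le> K + K * gagliardo_root k \<sigma> p u x powr (real l / s)"
proof -
  let ?g = "gagliardo_root k \<sigma> p u"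
  have s0: "s > 0" and ls: "0 < real l / s" "real l / s < 1"
    using \<sigma> s len by auto
  have g0: "?g x \<ge> 0" for x by (rule gagliardo_root_nonneg[OF reg p])
  \<comment> \<open>Adding 1 makes the base at least 1, so that its powers increase with the
    exponent and j/s can be raised to l/s.\<close>
  have up: "(?g x + 1) powr a \<le> 2 * (1 + ?g x powr (real l / s))" if "a \<le> real l / s" for a x
  proof -
    have "(?g x + 1) powr a \<le> (?g x + 1) powr (real l / s)"
      using that g0[of x] by (intro powr_mono) auto
    also have "\<dots> \<le> 2 * (1 + ?g x powr (real l / s))"
      using ls g0[of x] by (intro powr_plus_one_le) auto
    finally show ?thesis .
  qed
  show ?thesis
  proof (cases "is = []")
    case False
    define j where "j = length is"
    have j: "1 \<le> j" "j \<le> k" "j \<le> l"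
      using False len by (auto simp: j_def Suc_le_eq)
    obtain C where C: "C \<ge> 0" "AE x in lebesgue. \<bar>weak_deriv u is x\<bar> \<le>
        C * (bmo_seminorm u powr (1 - real j / s) * ?g x powr (real j / s))"
      using weak_deriv_pointwise_bound[OF p \<sigma> _ j(1,2) s, of "is"] reg j_def by blast
    define K where "K = C * bmo_seminorm u powr (1 - real j / s)"
    have K: "K \<ge> 0" using C(1) by (simp add: K_def)
    have "AE x in lebesgue. \<bar>weak_deriv u is x\<bar> \<le> 2 * K + 2 * K * ?g x powr (real l / s)"
      using C(2)
    proof eventually_elim
      case (elim x)
      have "?g x powr (real j / s) \<le> (?g x + 1) powr (real j / s)"
        using g0[of x] s0 by (intro powr_mono2) auto
      also have "\<dots> \<le> 2 * (1 + ?g x powr (real l / s))"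
        using j s0 by (intro up divide_right_mono) auto
      finally have "K * ?g x powr (real j / s) \<le> K * (2 * (1 + ?g x powr (real l / s)))"
        using K by (rule mult_left_mono)
      then show ?case
        using elim by (simp add: K_def algebra_simps)
    qed
    then show ?thesis
      using K by (intro exI[of _ "2 * K"]) auto
  next
    case True
    let ?v = "weak_deriv u []"
    have v: "locally_integrable ?v"
      using regular_weak_deriv(2)[OF reg p] by simp
    obtain A where A: "\<And>x. \<bar>dilate_avg unit_bump ?v x 1\<bar> \<le> A"
      using dilate_avg_Lp_bounded[OF unit_bump_kernel _ v p] Lp True by blast
    have A0: "A \<ge> 0" by (rule order_trans[OF abs_ge_zero A])
    obtain C where C: "C \<ge> 0" "\<And>(u :: real ^ 'n \<Rightarrow> real) b x g \<rho> A. controlled k \<sigma> p u b x g \<Longrightarrow> 0 < \<rho> \<Longrightarrow> \<rho> \<le> 1 \<Longrightarrow>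
      \<bar>dilate_avg unit_bump (weak_deriv u []) x 1\<bar> \<le> A \<Longrightarrow>
      \<bar>dilate_avg unit_bump (weak_deriv u []) x \<rho>\<bar> \<le> A + C * (1 + b) * (1 + g powr (1 / s))"
      using dilate_avg_order_zero[OF p \<sigma> unit_bump_kernel _ s] len by (meson le_trans)
    define c where "c = (LINT y|lebesgue. (unit_bump (y :: real ^ 'n) :: real))"
    have c: "c > 0" using integral_unit_bump_pos unfolding c_def .
    \<comment> \<open>The factor 1 + b for the majorant b with \<epsilon> = 1; a crude constant is
      enough here, so no limit in \<epsilon> is taken.\<close>
    define K where "K = C * (1 + (bmo_seminorm u + 1))"
    have K: "K \<ge> 0" using C(1) by (simp add: K_def bmo_seminorm_def)
    have "AE x in lebesgue. c * \<bar>?v x\<bar> \<le> (A + K) + K * (?g x + 1) powr (1 / s)"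
      unfolding c_def
    proof (rule dilate_avg_bound_imp_abs_le[OF unit_bump_kernel unit_bump_even v])
      show "locally_integrable (\<lambda>x. (A + K) + K * (?g x + 1) powr (1 / s))"
        by (rule locally_integrable_add[OF locally_integrable_const locally_integrable_gagliardo_root[OF reg p]])
           (use K s len \<sigma> in auto)
      show "AE x in lebesgue. \<forall>\<rho>. 0 < \<rho> \<longrightarrow> \<rho> \<le> 1 \<longrightarrow>
          \<bar>dilate_avg unit_bump ?v x \<rho>\<bar> \<le> (A + K) + K * (?g x + 1) powr (1 / s)"
        using gagliardo_density_finite[OF reg p]
      proof eventually_elim
        case (elim x)
        show ?case
        proof (intro allI impI)
          fix \<rho> :: real assume "0 < \<rho>" "\<rho> \<le> 1"
          from C(2)[OF controlled_regular[OF reg p elim zero_less_one] this A]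
          show "\<bar>dilate_avg unit_bump ?v x \<rho>\<bar> \<le> (A + K) + K * (?g x + 1) powr (1 / s)"
            by (simp add: K_def algebra_simps)
        qed
      qed
    qed
    \<comment> \<open>Replacing the power by \<open>up\<close> adds 2 K to the constant A + K,
      whence 3 K; \<open>c\<close> is the integral of the bump.\<close>
    then have "AE x in lebesgue. \<bar>?v x\<bar> \<le> (A + 3 * K) / c + (A + 3 * K) / c * ?g x powr (real l / s)"
    proof eventually_elim
      case (elim x)
      have "1 / s \<le> real l / s"
        using len s0 by (intro divide_right_mono) auto
      from mult_left_mono[OF up[OF this, of x] K]
      have "c * \<bar>?v x\<bar> \<le> (A + 3 * K) + 2 * K * ?g x powr (real l / s)"
        using elim by (simp add: algebra_simps)
      also have "\<dots> \<le> (A + 3 * K) + (A + 3 * K) * ?g x powr (real l / s)"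
        using A0 K by (intro add_left_mono mult_right_mono) auto
      finally have "\<bar>?v x\<bar> \<le> ((A + 3 * K) + (A + 3 * K) * ?g x powr (real l / s)) / c"
        using c by (simp add: le_divide_eq mult.commute)
      then show ?case
        by (simp only: add_divide_distrib[of "A + 3 * K"] times_divide_eq_left)
    qed
    then show ?thesis
      using True A0 K c by (intro exI[of _ "(A + 3 * K) / c"]) auto
  qed
qed

lemma Lp_space_cong_AE:
  assumes "f \<in> Lp_space p" "g \<in> borel_measurable lebesgue" "AE x in lebesgue. f x = g x"
  shows "g \<in> Lp_space p"
proof -
  have "integrable lebesgue (\<lambda>x. \<bar>g x\<bar> powr p)"
  proof (subst integrable_cong_AE)
    show "AE x in lebesgue. \<bar>g x\<bar> powr p = \<bar>f x\<bar> powr p"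
      using assms(3) by eventually_elim simp
  qed (use assms in \<open>auto simp: Lp_space_def\<close>)
  then show ?thesis
    using assms(2) by (simp add: Lp_space_def)
qed

theorem mainTheorem3:
  fixes l :: nat and s p :: real
  assumes "l \<ge> 1" and "s > real l" and "s \<notin> \<nat>" and "p \<ge> 1"
  shows "\<exists>C::real. \<forall>u :: real ^ 'n \<Rightarrow> real. u \<in> frac_sobolev s p \<inter> BMO \<longrightarrow>
           u \<in> sobolev l (s * p / real l) \<and>
           Lp_norm (s * p / real l) (\<lambda>x. tensor_norm l (\<lambda>is. weak_deriv u is x))
             \<le> C * bmo_seminorm u powr (1 - real l / s)
                 * frac_sobolev_seminorm s p u powr (real l / s)"
proof -
  define k where "k = nat \<lfloor>s\<rfloor>"
  define \<sigma> where "\<sigma> = frac s"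
  define q where "q = s * p / real l"
  have l0: "real l > 0" and s0: "s > 0"
    using assms by auto
  have s_eq: "s = real k + \<sigma>"
    using s0 by (simp add: k_def \<sigma>_def frac_def)
  have lk: "l \<le> k"
    using assms by (simp add: k_def le_nat_floor)
  have \<sigma>: "\<sigma> > 0"
  proof -
    have "\<sigma> \<noteq> 0"
      using assms(3) s_eq by auto
    then show ?thesis
      using frac_ge_0[of s] by (simp add: \<sigma>_def)
  qed
  \<comment> \<open>The third relation turns the power q of g^(l/s) into g^p, whose integral is the
    energy.\<close>
  have q: "q \<ge> p" "q > 0" "real l / s * q = p"
  proof -
    have "p * real l \<le> p * s" using assms by (intro mult_left_mono) auto
    then show "q \<ge> p" using l0 by (simp add: q_def le_divide_eq mult.commute)
    then show "q > 0" using assms by simp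
    show "real l / s * q = p" using l0 s0 by (simp add: q_def)
  qed
  \<comment> \<open>The condition on the length stands inside the existential so that
    \<open>choice\<close> yields a constant for every list.\<close>
  have "\<forall>is. \<exists>C\<ge>0. length (is :: 'n list) = l \<longrightarrow> (\<forall>u :: real ^ 'n \<Rightarrow> real. regular k \<sigma> p u \<longrightarrow> (AE x in lebesgue.
    \<bar>weak_deriv u is x\<bar> \<le> C * (bmo_seminorm u powr (1 - real l / s) * gagliardo_root k \<sigma> p u x powr (real l / s))))"
  proof
    fix "is" :: "'n list"
    show "\<exists>C\<ge>0. length is = l \<longrightarrow> (\<forall>u :: real ^ 'n \<Rightarrow> real. regular k \<sigma> p u \<longrightarrow> (AE x in lebesgue.
      \<bar>weak_deriv u is x\<bar> \<le> C * (bmo_seminorm u powr (1 - real l / s) * gagliardo_root k \<sigma> p u x powr (real l / s))))"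
    proof (cases "length is = l")
      case True
      then show ?thesis
        using weak_deriv_pointwise_bound[OF assms(4) \<sigma> True assms(1) lk s_eq] by simp
    qed (auto intro: exI[of _ 0])
  qed
  from choice[OF this] obtain C where C: "\<And>is. C is \<ge> 0"
    "\<And>is u. length (is :: 'n list) = l \<Longrightarrow> regular k \<sigma> p (u :: real ^ 'n \<Rightarrow> real) \<Longrightarrow> AE x in lebesgue.
    \<bar>weak_deriv u is x\<bar> \<le> C is * (bmo_seminorm u powr (1 - real l / s) * gagliardo_root k \<sigma> p u x powr (real l / s))"
    by blast
  \<comment> \<open>The sum of the constants suffices because the Euclidean norm of the tensor is at
    most the sum of the absolute values of its components.\<close>
  define C' where "C' = (\<Sum>is | length is = l. C is)"
  have C': "C' \<ge> 0"
    unfolding C'_def by (intro sum_nonneg C)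
  have main: "u \<in> sobolev l q \<and> Lp_norm q (\<lambda>x. tensor_norm l (\<lambda>is. weak_deriv u is x))
      \<le> C' * bmo_seminorm u powr (1 - real l / s) * frac_sobolev_seminorm s p u powr (real l / s)"
    if u: "u \<in> frac_sobolev s p \<inter> BMO" for u :: "real ^ 'n \<Rightarrow> real"
  proof -
    let ?g = "gagliardo_root k \<sigma> p u"
    \<comment> \<open>Only bound variables are renamed: in the energy too, the inner integral runs
      over the first point of the difference.\<close>
    have energy: "gagliardo_energy s p u = (\<integral>\<^sup>+ x. gagliardo_density k \<sigma> p u x \<partial>lebesgue)"
      by (simp add: gagliardo_energy_def gagliardo_density_def k_def \<sigma>_def)
    have uLp: "u \<in> Lp_space p"
      using u by (simp add: frac_sobolev_def sobolev_def)
    have ex: "\<exists>g \<in> Lp_space p. has_weak_deriv u is g" if "length is \<le> k" for "is"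
      using u that by (auto simp: frac_sobolev_def sobolev_def k_def)
    have wd: "has_weak_deriv u is (weak_deriv u is)" if "length is \<le> k" for "is"
      using ex[OF that] unfolding weak_deriv_def by (metis someI)
    have reg: "regular k \<sigma> p u"
      using u wd energy by (auto simp: regular_def frac_sobolev_def BMO_def)
    have wdLp: "weak_deriv u is \<in> Lp_space p" if len: "length is \<le> k" for "is"
    proof -
      obtain g where g: "g \<in> Lp_space p" "has_weak_deriv u is g"
        using ex[OF len] by blast
      show ?thesis
        by (rule Lp_space_cong_AE[OF g(1) regular_weak_deriv(3)[OF reg assms(4) len]
              has_weak_deriv_unique[OF g(2) wd[OF len]]])
    qed
    have wdLq: "weak_deriv u is \<in> Lp_space q" if len: "length is \<le> l" for "is"
    proof -
      obtain K where K: "K \<ge> 0" "AE x in lebesgue. \<bar>weak_deriv u is x\<bar> \<le> K + K * ?g x powr (real l / s)"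
        using weak_deriv_lower_order_bound[OF assms(4) \<sigma> reg len assms(1) lk s_eq wdLp] len lk by auto
      show ?thesis
      proof (rule Lp_spaceI_dominated[OF wdLp _ _ _ _ q(1) K(1,2)])
        show "(\<lambda>x. K * ?g x powr (real l / s)) \<in> borel_measurable lebesgue"
          using gagliardo_root_measurable[OF reg assms(4)] by measurable
        have "(K * ?g x powr (real l / s)) powr q = K powr q * ?g x powr p" for x
          using K(1) q(3) by (simp add: powr_mult powr_powr)
        then show "integrable lebesgue (\<lambda>x. (K * ?g x powr (real l / s)) powr q)"
          using integral_gagliardo_root_powr(1)[OF reg assms(4)] by simp
      qed (use len lk K assms in auto)
    qed
    \<comment> \<open>Order zero was treated for the representative \<open>weak_deriv u []\<close>,
      which agrees with \<open>u\<close> almost everywhere by uniqueness.\<close>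
    have "u \<in> Lp_space q"
    proof (rule Lp_space_cong_AE[OF wdLq[of "[]"]])
      have "has_weak_deriv u [] u"
        using wd[of "[]"] by (simp add: has_weak_deriv_def)
      then show "AE x in lebesgue. weak_deriv u [] x = u x"
        using has_weak_deriv_unique wd[of "[]"] by (metis le0 list.size(3))
    qed (use uLp in \<open>auto simp: Lp_space_def\<close>)
    then have "u \<in> sobolev l q"
      using wdLq wd lk unfolding sobolev_def by (blast intro: le_trans)
    moreover have "Lp_norm q (\<lambda>x. tensor_norm l (\<lambda>is. weak_deriv u is x))
      \<le> C' * bmo_seminorm u powr (1 - real l / s) * frac_sobolev_seminorm s p u powr (real l / s)"
    proof -
      let ?T = "\<lambda>x. tensor_norm l (\<lambda>is. weak_deriv u is x)"
      define B where "B = C' * bmo_seminorm u powr (1 - real l / s)"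
      have B: "B \<ge> 0" using C' by (simp add: B_def)
      have T0: "?T x \<ge> 0" for x by (simp add: tensor_norm_def L2_set_def sum_nonneg)
      have "AE x in lebesgue. \<forall>is \<in> {is :: 'n list. length is = l}. \<bar>weak_deriv u is x\<bar> \<le>
          C is * (bmo_seminorm u powr (1 - real l / s) * ?g x powr (real l / s))"
        using C(2)[OF _ reg] by (intro AE_ball_countable' countable_finite finite_lists_length) auto
      then have le: "AE x in lebesgue. \<bar>?T x\<bar> powr q \<le> B powr q * ?g x powr p"
      proof eventually_elim
        case (elim x)
        have "?T x \<le> (\<Sum>is | length is = l. \<bar>weak_deriv u is x\<bar>)"
          unfolding tensor_norm_def by (rule L2_set_le_sum_abs)
        also have "\<dots> \<le> (\<Sum>is | length is = l. C is * (bmo_seminorm u powr (1 - real l / s) * ?g x powr (real l / s)))"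
          using elim by (intro sum_mono) auto
        also have "\<dots> = B * ?g x powr (real l / s)"
          by (simp add: B_def C'_def flip: sum_distrib_right)
        finally have "\<bar>?T x\<bar> powr q \<le> (B * ?g x powr (real l / s)) powr q"
          using T0[of x] q(2) by (intro powr_mono2) auto
        then show ?case
          using B q(3) by (simp add: powr_mult powr_powr)
      qed
      \<comment> \<open>Integrability is asked of the majorant alone; a non-integrable function
        would have Bochner integral 0.\<close>
      have "(LINT x|lebesgue. \<bar>?T x\<bar> powr q) \<le> (LINT x|lebesgue. B powr q * ?g x powr p)"
      proof (rule integral_mono_AE'[OF _ le])
        show "integrable lebesgue (\<lambda>x. B powr q * ?g x powr p)"
          using integral_gagliardo_root_powr(1)[OF reg assms(4)] by simp
      qed simp
      also have "\<dots> = B powr q * enn2real (gagliardo_energy s p u)"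
        using integral_gagliardo_root_powr(2)[OF reg assms(4)] by (simp add: energy)
      finally have "Lp_norm q ?T \<le> (B powr q * enn2real (gagliardo_energy s p u)) powr (1 / q)"
        unfolding Lp_norm_def using q(2) by (intro powr_mono2) auto
      also have "\<dots> = B * enn2real (gagliardo_energy s p u) powr (1 / q)"
        using B q(2) by (simp add: powr_mult powr_powr)
      \<comment> \<open>Here 1/q is the product of 1/p, the exponent in the semi-norm, and
        l/s.\<close>
      also have "enn2real (gagliardo_energy s p u) powr (1 / q) = frac_sobolev_seminorm s p u powr (real l / s)"
        using l0 s0 assms(4) by (simp add: frac_sobolev_seminorm_def powr_powr q_def field_simps)
      finally show ?thesis
        by (simp add: B_def)
    qed
    ultimately show ?thesis by blast
  qed
  then show ?thesis
    unfolding q_def by blast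
qed

end
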